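(* Let $r>0$ be an integer. There exists $\ell_0=\ell_0(r)$ such that for every integer $\ell>\ell_0$, $$f_3(\ell,r)<(10\,\ell\log\ell)^{r+1}.$$
   Context: Graphs are finite, simple and undirected. For a graph $G=(V,E)$, $v\in V$ and a positive integer $r$, the $r$-ball $U_r(v,G)$ is the subgraph of $G$ induced on all vertices at graph distance at most $r$ from $v$. The $r$-local chromatic number of $G$ is $\ell\chi_r(G)=\max_{v\in V}\chi(U_r(v,G))$, where $\chi$ is the chromatic number. For integers $\ell\ge c\ge 2$ and $r>0$, $f_c(\ell,r)$ is the greatest integer $n$ such that every graph on $n$ vertices whose $r$-local chromatic number is at most $c$ is $\ell$-colorable. $\log$ is the natural logarithm. *)

theory Defs
  imports
    "Graph_Theory.Pair_Digraph"
    "Graph_Theory.Digraph_Component"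
    "Graph_Theory.Shortest_Path"
    "HOL-Library.Extended_Nat"
begin

text \<open>
  A finite simple undirected graph is a \<open>pair_graph\<close>: its arc set is a finite symmetric irreflexive
  relation on its vertices, so every undirected edge is represented by its two orientations.
\<close>

definition proper_coloring :: "('a, 'b) pre_digraph \<Rightarrow> nat \<Rightarrow> ('a \<Rightarrow> nat) \<Rightarrow> bool" where
  "proper_coloring G k f \<longleftrightarrow>
     (\<forall>v\<in>verts G. f v < k) \<and> (\<forall>a\<in>arcs G. f (tail G a) \<noteq> f (head G a))"

definition colorable :: "('a, 'b) pre_digraph \<Rightarrow> nat \<Rightarrow> bool" where
  "colorable G k \<longleftrightarrow> (\<exists>f. proper_coloring G k f)"

definition chromatic_number :: "('a, 'b) pre_digraph \<Rightarrow> nat" where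
  "chromatic_number G = (LEAST k. colorable G k)"

text \<open>Graph distance: shortest walks for unit arc weights, \<open>\<infinity>\<close> if there is no walk.\<close>

definition graph_dist :: "('a, 'b) pre_digraph \<Rightarrow> 'a \<Rightarrow> 'a \<Rightarrow> ereal" where
  "graph_dist G u v = wf_digraph.\<mu> G (\<lambda>_. 1) u v"

definition graph_ball :: "nat \<Rightarrow> 'a \<Rightarrow> ('a, 'b) pre_digraph \<Rightarrow> ('a, 'b) pre_digraph" where
  "graph_ball r v G = G \<restriction> {u \<in> verts G. graph_dist G v u \<le> ereal (real r)}"

text \<open>
  For the graph without vertices the maximum is unspecified; this is harmless below, as that graph
  is colorable with any number of colors.
\<close>

definition local_chromatic_number :: "nat \<Rightarrow> ('a, 'b) pre_digraph \<Rightarrow> nat" where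
  "local_chromatic_number r G = (MAX v\<in>verts G. chromatic_number (graph_ball r v G))"

text \<open>
  Taking the vertices from \<^typ>\<open>nat\<close> is no restriction, since every finite graph is isomorphic to
  one with such vertices.
\<close>

definition locally_forces_colorable :: "nat \<Rightarrow> nat \<Rightarrow> nat \<Rightarrow> nat \<Rightarrow> bool" where
  "locally_forces_colorable c l r n \<longleftrightarrow>
     (\<forall>G :: nat pair_pre_digraph.
        pair_graph G \<and> card (pverts G) = n \<and> local_chromatic_number r (with_proj G) \<le> c
        \<longrightarrow> colorable (with_proj G) l)"

text \<open>
  The value \<open>\<infinity>\<close> means that there is no greatest \<open>n\<close>; hence an upper bound on
  \<open>local_threshold c l r\<close> includes the assertion that the greatest \<open>n\<close> exists.
\<close>

definition local_threshold :: "nat \<Rightarrow> nat \<Rightarrow> nat \<Rightarrow> enat" where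
  "local_threshold c l r =
     (if \<exists>n. locally_forces_colorable c l r n \<and> (\<forall>m. locally_forces_colorable c l r m \<longrightarrow> m \<le> n)
      then enat (GREATEST n. locally_forces_colorable c l r n) else \<infinity>)"

lemma local_threshold_eq_enat_iff:
  "local_threshold c l r = enat n \<longleftrightarrow>
     locally_forces_colorable c l r n \<and> (\<forall>m. locally_forces_colorable c l r m \<longrightarrow> m \<le> n)"
  unfolding local_threshold_def
  by (auto intro: GreatestI_nat Greatest_le_nat Greatest_equality)

lemma locally_forces_colorable_0: "locally_forces_colorable c l r 0"
proof -
  have "colorable (with_proj G) l" if "pair_graph G" "card (pverts G) = 0" for G :: "nat pair_pre_digraph"
  proof -
    interpret pair_graph G by fact
    have "pverts G = {}" using that(2) pair_finite_verts by simp
    moreover from this have "parcs G = {}" using arc_fst_in_verts by auto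
    ultimately show ?thesis by (simp add: colorable_def proper_coloring_def)
  qed
  then show ?thesis by (simp add: locally_forces_colorable_def)
qed

lemma graph_dist_le_iff:
  assumes "wf_digraph G"
  shows "graph_dist G u v \<le> ereal (real r) \<longleftrightarrow>
    (\<exists>p. pre_digraph.awalk G u p v \<and> length p \<le> r)"
proof -
  interpret wf_digraph G by fact
  have cost: "awalk_cost (\<lambda>_. 1) p = real (length p)" for p
    by (induct p) auto
  show ?thesis
  proof
    assume "graph_dist G u v \<le> ereal (real r)"
    also have "ereal (real r) < ereal (real (Suc r))" by simp
    finally obtain p where "awalk u p v" "ereal (real (length p)) < ereal (real (Suc r))"
      unfolding graph_dist_def \<mu>_def cost INF_less_iff by auto
    then show "\<exists>p. awalk u p v \<and> length p \<le> r" by auto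
  next
    assume "\<exists>p. awalk u p v \<and> length p \<le> r"
    then obtain p where p: "awalk u p v" "length p \<le> r" by auto
    have "graph_dist G u v \<le> ereal (real (length p))"
      using min_cost_le_walk_cost[OF p(1), of "\<lambda>_. 1"] by (simp add: graph_dist_def cost)
    also have "\<dots> \<le> ereal (real r)" using p(2) by simp
    finally show "graph_dist G u v \<le> ereal (real r)" .
  qed
qed

end

theory Submission
  imports Defs "HOL-Real_Asymp.Real_Asymp"
begin

text \<open>
  Write \<open>x = 10 l ln l\<close> and \<open>r = q + 1\<close>, let \<open>n\<close> be the integer part of $x^{r+1}$, and consider the
  random graph $G(n, p)$ with average degree about \<open>d = n p = x / 4\<close>. Its independent sets have at
  most about $2 n \ln d / d$ vertices, so even after deleting \<open>n / 10\<close> vertices it is not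
  \<open>l\<close>-colorable. It remains to see that, for all but a small fraction of the vertices \<open>v\<close>, the
  ball of radius \<open>r\<close> about \<open>v\<close> is 3-colorable; the exceptional vertices are then isolated.

  If a ball is not 3-colorable, it contains a nonempty set \<open>H\<close> of vertices inducing a subgraph of
  minimum degree at least 3. A breadth-first search tree reaches at most about $(2d)^r$ vertices, and
  an expected number of about $d^{2r+1} / n$, that is $d^r$ up to a constant, of further edges run
  inside the outermost layer. This layer is a subcritical random graph, as each of its vertices has
  on average at most about 1/8 neighbors in it, and it is a forest with probability close to 1. Then
  every vertex of \<open>H\<close> in the outermost layer lies on a path in this layer whose two ends send
  non-tree edges back to the inner part of the ball, and counting degrees bounds the size of \<open>H\<close>
  by the number of such paths and of non-tree edges in the inner part
  (\<open>min_degree_3_card_le\<close>). The expected value of this bound is a small multiple of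
  $d^{r-2}$ (\<open>prob_bad_le\<close>). On the other hand, \<open>H\<close> spans at least \<open>3 / 2\<close> times as many edges
  as it has vertices, which with probability at least 7/8 happens in $G(n, p)$ only for sets of at
  least $n / (36 d^3)$ vertices (\<open>prob_dense\<close>). This is a larger multiple of $d^{r-2}$, so
  \<open>H\<close> does not exist for most \<open>v\<close>.

  The search tree and the further edges are not independent. Instead of conditioning on the tree,
  the first moments are computed by deleting the non-tree edges of a given structure: this does not
  change any distance from \<open>v\<close> (\<open>nball_eq_of_tree\<close>), and it multiplies the probability of a
  graph by the factor \<open>(1 - p) / p\<close> for each edge (\<open>prob_contains_le\<close>).
\<close>

section \<open>Random subsets of a finite set\<close>

text \<open>
  The possible edges of a graph on the vertex set \<open>S\<close>: its two-element subsets. A graph on \<open>S\<close> is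
  represented by its edge set \<open>E \<subseteq> pairs S\<close>.
\<close>

definition pairs :: "'a set \<Rightarrow> 'a set set" where
  "pairs S = {e. e \<subseteq> S \<and> card e = 2}"

text \<open>
  Expectation over the random subset \<open>E\<close> of a finite set \<open>U\<close> that contains every element
  independently with probability \<open>p\<close>. For \<open>U = pairs V\<close> this is the random graph $G(n, p)$ on \<open>V\<close>.
\<close>

definition expect :: "real \<Rightarrow> 'e set \<Rightarrow> ('e set \<Rightarrow> real) \<Rightarrow> real" where
  "expect p U f = (\<Sum>E\<in>Pow U. p ^ card E * (1 - p) ^ card (U - E) * f E)"

definition prob :: "real \<Rightarrow> 'e set \<Rightarrow> ('e set \<Rightarrow> bool) \<Rightarrow> real" where
  "prob p U P = expect p U (\<lambda>E. of_bool (P E))"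

lemma finite_pairs: "finite S \<Longrightarrow> finite (pairs S)"
  by (simp add: pairs_def)

lemma card_pairs: "finite S \<Longrightarrow> card (pairs S) = card S choose 2"
  by (simp add: pairs_def n_subsets)

lemma pairs_mono: "S \<subseteq> T \<Longrightarrow> pairs S \<subseteq> pairs T"
  by (auto simp: pairs_def)

lemma insert_in_pairs_iff: "{x, y} \<in> pairs S \<longleftrightarrow> x \<in> S \<and> y \<in> S \<and> x \<noteq> y"
  by (auto simp: pairs_def card_insert_if)

lemma of_card_pairs_le: "finite S \<Longrightarrow> real (card (pairs S)) \<le> real (card S) ^ 2 / 2"
proof -
  assume "finite S"
  then have "real (card (pairs S)) = real (card S * (card S - 1) div 2)"
    by (simp add: card_pairs choose_two)
  also have "\<dots> \<le> real (card S * (card S - 1)) / 2"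
    by linarith
  also have "\<dots> \<le> real (card S * card S) / 2"
    by (intro divide_right_mono of_nat_mono mult_le_mono) auto
  finally show ?thesis by (simp add: power2_eq_square)
qed

lemma expect_mono:
  assumes "0 \<le> p" "p \<le> 1" "\<And>E. E \<subseteq> U \<Longrightarrow> f E \<le> g E"
  shows "expect p U f \<le> expect p U g"
  unfolding expect_def using assms by (intro sum_mono mult_left_mono) auto

lemma expect_cmult: "expect p U (\<lambda>E. c * f E) = c * expect p U f"
  by (simp add: expect_def sum_distrib_left mult_ac)

lemma expect_add: "expect p U (\<lambda>E. f E + g E) = expect p U f + expect p U g"
  by (simp add: expect_def sum.distrib distrib_left)

lemma expect_sum: "expect p U (\<lambda>E. \<Sum>i\<in>I. f i E) = (\<Sum>i\<in>I. expect p U (f i))"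
proof -
  have "(\<Sum>E\<in>Pow U. \<Sum>i\<in>I. p ^ card E * (1 - p) ^ card (U - E) * f i E) =
        (\<Sum>i\<in>I. \<Sum>E\<in>Pow U. p ^ card E * (1 - p) ^ card (U - E) * f i E)"
    by (rule sum.swap)
  then show ?thesis by (simp add: expect_def sum_distrib_left)
qed

text \<open>
  The generating function of the number of random elements in a fixed set \<open>A\<close>. The value
  \<open>z = 0\<close> gives the probability that \<open>A\<close> is avoided, and values \<open>z > 1\<close> give Chernoff bounds.
\<close>

lemma expect_power_card_Int:
  assumes "finite U" "A \<subseteq> U"
  shows "expect p U (\<lambda>E. z ^ card (E \<inter> A)) = (1 + (z - 1) * p) ^ card A"
proof -
  have fA: "finite A" using assms finite_subset by blast
  let ?f = "\<lambda>e. if e \<in> A then z * p else p"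
  have "(\<Prod>e\<in>U. ?f e + (1 - p)) = (\<Sum>E\<in>Pow U. (\<Prod>e\<in>E. ?f e) * (\<Prod>e\<in>U - E. (1 - p)))"
    by (rule prod_add) fact
  also have "\<dots> = expect p U (\<lambda>E. z ^ card (E \<inter> A))"
    unfolding expect_def
  proof (rule sum.cong[OF refl])
    fix E assume "E \<in> Pow U"
    then have fE: "finite E" using assms finite_subset by blast
    have "(\<Prod>e\<in>E. ?f e) = (\<Prod>e\<in>E. (if e \<in> A then z else 1) * p)"
      by (rule prod.cong) auto
    also have "\<dots> = (\<Prod>e\<in>E \<inter> A. z) * p ^ card E"
      by (subst prod.distrib, subst prod.inter_restrict[OF fE]) simp
    finally show "prod ?f E * (\<Prod>e\<in>U - E. (1 - p)) =
        p ^ card E * (1 - p) ^ card (U - E) * z ^ card (E \<inter> A)" by simp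
  qed
  finally have "expect p U (\<lambda>E. z ^ card (E \<inter> A)) = (\<Prod>e\<in>U. ?f e + (1 - p))" by simp
  also have "\<dots> = (\<Prod>e\<in>U. if e \<in> A then 1 + (z - 1) * p else 1)"
    by (rule prod.cong) (auto simp: algebra_simps)
  also have "\<dots> = (\<Prod>e\<in>U \<inter> A. 1 + (z - 1) * p)"
    by (rule prod.inter_restrict[symmetric]) fact
  also have "U \<inter> A = A" using assms by blast
  finally show ?thesis by simp
qed

lemma expect_const: "finite U \<Longrightarrow> expect p U (\<lambda>_. c) = c"
  using expect_power_card_Int[of U "{}" p 1] expect_cmult[of p U c "\<lambda>_. 1"] by simp

lemma prob_avoid:
  assumes "finite U" "A \<subseteq> U"
  shows "prob p U (\<lambda>E. E \<inter> A = {}) = (1 - p) ^ card A"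
proof -
  have "prob p U (\<lambda>E. E \<inter> A = {}) = expect p U (\<lambda>E. 0 ^ card (E \<inter> A))"
    unfolding prob_def expect_def
  proof (rule sum.cong[OF refl])
    fix E assume "E \<in> Pow U"
    then have "finite (E \<inter> A)" using assms finite_subset by blast
    then show "p ^ card E * (1 - p) ^ card (U - E) * of_bool (E \<inter> A = {}) =
          p ^ card E * (1 - p) ^ card (U - E) * 0 ^ card (E \<inter> A)"
      by (cases "E \<inter> A = {}") (auto simp: power_0_left)
  qed
  then show ?thesis using expect_power_card_Int[OF assms, of p 0] by simp
qed

lemma prob_mono:
  assumes "0 \<le> p" "p \<le> 1" "\<And>E. E \<subseteq> U \<Longrightarrow> P E \<Longrightarrow> Q E"
  shows "prob p U P \<le> prob p U Q"
  unfolding prob_def using assms by (intro expect_mono) auto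

lemma prob_le_expect:
  assumes "0 \<le> p" "p \<le> 1" "0 < c" "\<And>E. E \<subseteq> U \<Longrightarrow> 0 \<le> f E"
    and "\<And>E. E \<subseteq> U \<Longrightarrow> P E \<Longrightarrow> c \<le> f E"
  shows "prob p U P \<le> expect p U f / c"
proof -
  have "prob p U P \<le> expect p U (\<lambda>E. (1 / c) * f E)"
    unfolding prob_def using assms by (intro expect_mono) (auto simp: field_simps)
  then show ?thesis by (simp only: expect_cmult) simp
qed

lemma prob_disj_le:
  assumes "0 \<le> p" "p \<le> 1"
  shows "prob p U (\<lambda>E. P E \<or> Q E) \<le> prob p U P + prob p U Q"
proof -
  have "prob p U (\<lambda>E. P E \<or> Q E) \<le> expect p U (\<lambda>E. of_bool (P E) + of_bool (Q E))"
    unfolding prob_def by (intro expect_mono assms) auto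
  then show ?thesis by (simp add: expect_add prob_def)
qed

lemma prob_Bex_le:
  assumes "0 \<le> p" "p \<le> 1" "finite I"
  shows "prob p U (\<lambda>E. \<exists>i\<in>I. P i E) \<le> (\<Sum>i\<in>I. prob p U (P i))"
proof -
  have "prob p U (\<lambda>E. \<exists>i\<in>I. P i E) \<le> expect p U (\<lambda>E. \<Sum>i\<in>I. of_bool (P i E))"
    unfolding prob_def
  proof (intro expect_mono assms)
    fix E
    show "of_bool (\<exists>i\<in>I. P i E) \<le> (\<Sum>i\<in>I. of_bool (P i E) :: real)"
    proof (cases "\<exists>i\<in>I. P i E")
      case True
      then obtain i where i: "i \<in> I" "P i E" by blast
      have "(of_bool (P i E) :: real) \<le> (\<Sum>i\<in>I. of_bool (P i E))"
        using i assms(3) by (intro member_le_sum) auto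
      then show ?thesis using i by auto
    qed (auto intro: sum_nonneg)
  qed
  then show ?thesis by (simp add: expect_sum prob_def)
qed

lemma ex_if_prob_less_1:
  assumes "0 \<le> p" "p \<le> 1" "finite U" "prob p U P < 1"
  obtains E where "E \<subseteq> U" "\<not> P E"
proof -
  have "\<not> (\<forall>E. E \<subseteq> U \<longrightarrow> P E)"
  proof
    assume "\<forall>E. E \<subseteq> U \<longrightarrow> P E"
    then have "prob p U (\<lambda>_. True) \<le> prob p U P" by (intro prob_mono assms) auto
    then show False using assms(4) expect_const[OF assms(3), of p 1] by (simp add: prob_def)
  qed
  then show ?thesis using that by blast
qed

text \<open>
  Deleting a fixed set \<open>X\<close> of elements is injective on the sets that contain \<open>X\<close>, and it multiplies
  the weight of such a set by \<open>(1 - p) / p\<close> for each deleted element. This replaces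
  conditioning: if an event survives the deletion of \<open>X\<close>, then demanding \<open>X\<close> in addition costs
  a factor of at most \<open>(p / (1 - p)) ^ card X\<close>.
\<close>

lemma prob_contains_le:
  assumes "0 \<le> p" "p < 1" "finite U" "X \<subseteq> U"
    and rem: "\<And>E. E \<subseteq> U \<Longrightarrow> X \<subseteq> E \<Longrightarrow> P E \<Longrightarrow> Q (E - X)"
  shows "prob p U (\<lambda>E. X \<subseteq> E \<and> P E) \<le> (p / (1 - p)) ^ card X * prob p U Q"
proof -
  let ?w = "\<lambda>E. p ^ card E * (1 - p) ^ card (U - E)"
  have fin: "finite X" using assms finite_subset by blast
  have "prob p U (\<lambda>E. X \<subseteq> E \<and> P E) = (\<Sum>E\<in>{E. E \<subseteq> U \<and> X \<subseteq> E \<and> P E}. ?w E)"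
    unfolding prob_def expect_def using assms(3)
    by (intro sum.mono_neutral_cong_right) auto
  also have "\<dots> = (\<Sum>E\<in>{E. E \<subseteq> U \<and> X \<subseteq> E \<and> P E}. (p / (1 - p)) ^ card X * ?w (E - X))"
  proof (rule sum.cong[OF refl])
    fix E assume E: "E \<in> {E. E \<subseteq> U \<and> X \<subseteq> E \<and> P E}"
    then have fE: "finite E" using assms finite_subset by blast
    have 1: "card E = card X + card (E - X)"
      using E fE by (simp add: card_Diff_subset card_mono fin)
    have "U - (E - X) = (U - E) \<union> X" using E assms(4) by auto
    then have 2: "card (U - (E - X)) = card (U - E) + card X"
      using E fin assms(3) by (subst card_Un_disjoint[symmetric]) auto
    have "(1 - p) \<noteq> 0" using assms by simp
    then show "?w E = (p / (1 - p)) ^ card X * ?w (E - X)"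
      unfolding 1 2 by (simp add: power_add power_divide)
  qed
  also have "\<dots> = (p / (1 - p)) ^ card X * (\<Sum>E\<in>(\<lambda>E. E - X) ` {E. E \<subseteq> U \<and> X \<subseteq> E \<and> P E}. ?w E)"
    by (subst sum.reindex) (auto simp: sum_distrib_left inj_on_def)
  also have "\<dots> \<le> (p / (1 - p)) ^ card X * (\<Sum>E\<in>{E. E \<subseteq> U \<and> Q E}. ?w E)"
    using assms rem by (intro mult_left_mono sum_mono2) auto
  also have "(\<Sum>E\<in>{E. E \<subseteq> U \<and> Q E}. ?w E) = prob p U Q"
    unfolding prob_def expect_def using assms(3)
    by (intro sum.mono_neutral_cong_left) auto
  finally show ?thesis .
qed

section \<open>Balls, search trees and paths\<close>

text \<open>
  The vertices at distance at most \<open>i\<close> from \<open>v\<close>.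
\<close>

primrec nball :: "'a set set \<Rightarrow> 'a \<Rightarrow> nat \<Rightarrow> 'a set" where
  "nball E v 0 = {v}"
| "nball E v (Suc i) = nball E v i \<union> {y. \<exists>x\<in>nball E v i. {x, y} \<in> E}"

text \<open>
  The vertices at distance exactly \<open>i + 1\<close> from \<open>v\<close>.
\<close>

definition layer :: "'a set set \<Rightarrow> 'a \<Rightarrow> nat \<Rightarrow> 'a set" where
  "layer E v i = nball E v (Suc i) - nball E v i"

text \<open>
  A chosen neighbor of \<open>y\<close> that is closer to \<open>v\<close> (unspecified for \<open>y = v\<close> and for \<open>y\<close> not
  reachable from \<open>v\<close>).
\<close>

definition parent :: "'a set set \<Rightarrow> 'a \<Rightarrow> 'a \<Rightarrow> 'a" where
  "parent E v y = (SOME x. \<exists>i. y \<in> layer E v i \<and> x \<in> nball E v i \<and> {x, y} \<in> E)"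

text \<open>
  The edges of a breadth-first search tree rooted at \<open>v\<close>.
\<close>

definition tree :: "'a set set \<Rightarrow> 'a \<Rightarrow> 'a set set" where
  "tree E v = {{y, parent E v y} | y i. y \<in> layer E v i}"

lemma nball_mono: "i \<le> j \<Longrightarrow> nball E v i \<subseteq> nball E v j"
  by (induction j) (auto simp: le_Suc_eq)

lemma nball_mono_edges: "E' \<subseteq> E \<Longrightarrow> nball E' v i \<subseteq> nball E v i"
  by (induction i) auto

lemma nball_subset:
  assumes "E \<subseteq> pairs V" "v \<in> V"
  shows "nball E v i \<subseteq> V"
  using assms by (induction i) (auto simp: pairs_def)

lemma layer_unique:
  assumes "y \<in> layer E v i" "y \<in> layer E v j"
  shows "i = j"
proof (rule ccontr)
  assume "i \<noteq> j"
  then have "Suc i \<le> j \<or> Suc j \<le> i" by auto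
  then show False using assms nball_mono[of "Suc i" j E v] nball_mono[of "Suc j" i E v]
    unfolding layer_def by blast
qed

lemma parent:
  assumes "y \<in> layer E v i"
  shows "parent E v y \<in> nball E v i" "{y, parent E v y} \<in> E"
proof -
  have "\<exists>x i. y \<in> layer E v i \<and> x \<in> nball E v i \<and> {x, y} \<in> E"
    using assms by (auto simp: layer_def)
  then have "\<exists>i. y \<in> layer E v i \<and> parent E v y \<in> nball E v i \<and> {parent E v y, y} \<in> E"
    unfolding parent_def by (rule someI_ex)
  then show "parent E v y \<in> nball E v i" "{y, parent E v y} \<in> E"
    using layer_unique[OF assms] by (auto simp: insert_commute)
qed

lemma tree_subset: "tree E v \<subseteq> E"
  by (auto simp: tree_def parent)

lemma tree_I: "y \<in> layer E v i \<Longrightarrow> {y, parent E v y} \<in> tree E v"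
  by (auto simp: tree_def)

text \<open>
  Edges outside the tree can be deleted without changing any distance from \<open>v\<close>.
\<close>

lemma nball_eq_of_tree:
  assumes "tree E v \<subseteq> E'" "E' \<subseteq> E"
  shows "nball E' v i = nball E v i"
proof (induction i)
  case (Suc i)
  have "nball E v (Suc i) \<subseteq> nball E' v (Suc i)"
  proof
    fix y assume y: "y \<in> nball E v (Suc i)"
    show "y \<in> nball E' v (Suc i)"
    proof (cases "y \<in> nball E v i")
      case False
      then have l: "y \<in> layer E v i" using y by (simp add: layer_def)
      then have "{parent E v y, y} \<in> E'" using tree_I[OF l] assms by (auto simp: insert_commute)
      then show ?thesis using parent(1)[OF l] Suc by auto
    qed (use Suc in auto)
  qed
  then show ?case using nball_mono_edges[OF assms(2), of v "Suc i"] by blast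
qed simp

lemma layer_eq_of_tree:
  assumes "tree E v \<subseteq> E'" "E' \<subseteq> E"
  shows "layer E' v i = layer E v i"
  unfolding layer_def nball_eq_of_tree[OF assms] ..

lemma tree_not_in_layer:
  assumes "x \<in> layer E v q" "x' \<in> layer E v q"
  shows "{x, x'} \<notin> tree E v"
proof
  assume "{x, x'} \<in> tree E v"
  then obtain y i where y: "{x, x'} = {y, parent E v y}" "y \<in> layer E v i"
    unfolding tree_def by blast
  then have *: "y \<in> {x, x'}" "parent E v y \<in> {x, x'}" by auto
  then have "i = q" using y(2) assms layer_unique by (metis insertE singletonD)
  then show False using parent(1)[OF y(2)] * assms by (auto simp: layer_def)
qed

lemma tree_to_ball:
  assumes "x \<in> layer E v q" "y \<in> nball E v q" "{x, y} \<in> tree E v"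
  shows "y = parent E v x"
proof -
  obtain y' i where y': "{x, y} = {y', parent E v y'}" "y' \<in> layer E v i"
    using assms(3) unfolding tree_def by blast
  show ?thesis
  proof (cases "y' = x")
    case True
    then show ?thesis using y' assms unfolding layer_def by (auto simp: doubleton_eq_iff)
  next
    case False
    then have e: "y' = y" "parent E v y' = x" using y' by (auto simp: doubleton_eq_iff)
    have "\<not> q \<le> i" using y'(2) e assms(2) nball_mono[of q i E v] by (auto simp: layer_def)
    then have "x \<in> nball E v q" using parent(1)[OF y'(2)] e nball_mono[of i q E v] by auto
    then show ?thesis using assms(1) by (simp add: layer_def)
  qed
qed

text \<open>
  The edges between consecutive vertices of a list.
\<close>

fun path_edges :: "'a list \<Rightarrow> 'a set set" where
  "path_edges (x # y # xs) = insert {x, y} (path_edges (y # xs))"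
| "path_edges _ = {}"

lemma path_edges_append:
  "xs \<noteq> [] \<Longrightarrow> ys \<noteq> [] \<Longrightarrow>
    path_edges (xs @ ys) = path_edges xs \<union> insert {last xs, hd ys} (path_edges ys)"
  by (induction xs rule: path_edges.induct) (auto simp: neq_Nil_conv)

lemma path_edges_rev: "path_edges (rev xs) = path_edges xs"
proof (induction xs rule: path_edges.induct)
  case (1 x y xs)
  then have "path_edges ((rev xs @ [y]) @ [x]) = insert {y, x} (path_edges (y # xs))"
    by (subst path_edges_append) auto
  then show ?case by (simp add: insert_commute)
qed auto

lemma path_edges_subset: "e \<in> path_edges xs \<Longrightarrow> e \<subseteq> set xs"
  by (induction xs rule: path_edges.induct) auto

lemma path_edges_pairs: "distinct xs \<Longrightarrow> path_edges xs \<subseteq> pairs (set xs)"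
  by (induction xs rule: path_edges.induct) (auto simp: insert_in_pairs_iff pairs_def)

lemma finite_path_edges [simp]: "finite (path_edges xs)"
  by (induction xs rule: path_edges.induct) auto

lemma card_path_edges: "distinct xs \<Longrightarrow> card (path_edges xs) = length xs - 1"
proof (induction xs rule: path_edges.induct)
  case (1 x y xs)
  then have "{x, y} \<notin> path_edges (y # xs)" using path_edges_subset[of "{x, y}" "y # xs"] by auto
  then show ?case using 1 by simp
qed auto

text \<open>
  A path with all vertices in \<open>S\<close>; a single vertex is a path.
\<close>

definition is_path :: "'a set set \<Rightarrow> 'a set \<Rightarrow> 'a list \<Rightarrow> bool" where
  "is_path E S xs \<longleftrightarrow> xs \<noteq> [] \<and> distinct xs \<and> set xs \<subseteq> S \<and> path_edges xs \<subseteq> E"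

definition is_cycle :: "'a set set \<Rightarrow> 'a set \<Rightarrow> 'a list \<Rightarrow> bool" where
  "is_cycle E S xs \<longleftrightarrow> is_path E S xs \<and> 3 \<le> length xs \<and> {last xs, hd xs} \<in> E"

lemma is_path_rev: "is_path E S (rev xs) \<longleftrightarrow> is_path E S xs"
  by (simp add: is_path_def path_edges_rev)

lemma is_path_snoc:
  "is_path E S xs \<Longrightarrow> w \<in> S \<Longrightarrow> w \<notin> set xs \<Longrightarrow> {last xs, w} \<in> E \<Longrightarrow> is_path E S (xs @ [w])"
  by (auto simp: is_path_def path_edges_append)

lemma is_path_suffix: "is_path E S (xs @ ys) \<Longrightarrow> ys \<noteq> [] \<Longrightarrow> is_path E S ys"
  by (cases "xs = []") (auto simp: is_path_def path_edges_append)

text \<open>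
  In this and the next two lemmas \<open>S\<close> induces a forest, and \<open>Sec x\<close> is a set of further half-edges
  at \<open>x\<close>. If every vertex of \<open>S\<close> has in total at least two forest edges and half-edges, then a path
  on two or more vertices of \<open>S\<close> that cannot be extended ends at a vertex with a half-edge, for otherwise its last vertex would
  have a second neighbor on the path, which closes a cycle.
\<close>

lemma extend_path:
  assumes fin: "finite S" and acyc: "\<nexists>c. is_cycle E S c" and E: "E \<subseteq> pairs V"
    and deg: "\<And>x. x \<in> S \<Longrightarrow> 2 \<le> card {w \<in> S. {x, w} \<in> E} \<or> Sec x \<noteq> {}"
    and xs: "is_path E S xs" "2 \<le> length xs"
  obtains ys where "is_path E S (xs @ ys)" "Sec (last (xs @ ys)) \<noteq> {}"
proof -
  have "\<exists>ys. is_path E S (xs @ ys) \<and> Sec (last (xs @ ys)) \<noteq> {}"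
    using xs
  proof (induction "card (S - set xs)" arbitrary: xs rule: less_induct)
    case less
    show ?case
    proof (cases "Sec (last xs) = {}")
      case True
      obtain us a where us: "xs = us @ [a, last xs]"
      proof -
        have ne: "butlast xs \<noteq> []" using less.prems(2) by (cases xs) auto
        then have "xs = butlast (butlast xs) @ [last (butlast xs), last xs]"
          using less.prems(2) by (metis append.assoc append_Cons append_Nil append_butlast_last_id butlast.simps(1))
        then show ?thesis using that by blast
      qed
      define l where "l = last xs"
      have l: "l \<in> S" using less.prems l_def by (auto simp: is_path_def)
      then have "2 \<le> card {w \<in> S. {l, w} \<in> E}" using deg[OF l] True l_def by auto
      moreover have "card {w \<in> S. {l, w} \<in> E} \<le> 1" if "\<And>w. w \<in> S \<Longrightarrow> {l, w} \<in> E \<Longrightarrow> w = a"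
        using that by (intro card_le_Suc0_iff_eq[THEN iffD2, unfolded One_nat_def[symmetric]])
          (use fin in auto)
      \<comment> \<open>Here \<open>a\<close> precedes the last vertex \<open>l\<close>; another neighbor \<open>w\<close> extends the path or closes a cycle.\<close>
      ultimately obtain w where w: "w \<in> S" "{l, w} \<in> E" "w \<noteq> a" by fastforce
      have "w \<noteq> l" using w(2) E by (auto simp: pairs_def)
      have "w \<notin> set xs"
      proof
        assume "w \<in> set xs"
        then have "w \<in> set us" using us w(3) \<open>w \<noteq> l\<close> l_def
          by (metis UnE empty_iff empty_set insert_iff list.simps(15) set_append)
        then obtain bs cs where b: "us = bs @ w # cs" by (meson split_list)
        then have "xs = bs @ (w # cs @ [a, l])" using us l_def by simp
        then have "is_cycle E S (w # cs @ [a, l])"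
          using less.prems(1) w(2) is_path_suffix[of E S bs "w # cs @ [a, l]"]
          by (auto simp: is_cycle_def)
        then show False using acyc by blast
      qed
      then have p: "is_path E S (xs @ [w])"
        using is_path_snoc[OF less.prems(1) w(1)] w(2) by (simp add: l_def)
      have "card (S - set (xs @ [w])) < card (S - set xs)"
        using w \<open>w \<notin> set xs\<close> fin by (intro psubset_card_mono) auto
      moreover have "2 \<le> length (xs @ [w])" using less.prems(2) by simp
      ultimately obtain ys where
        "is_path E S ((xs @ [w]) @ ys)" "Sec (last ((xs @ [w]) @ ys)) \<noteq> {}"
        using less.hyps[OF _ p] by blast
      then show ?thesis by (intro exI[of _ "w # ys"]) simp
    qed (use less.prems in \<open>intro exI[of _ "[]"]; simp\<close>)
  qed
  then show ?thesis using that by blast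
qed

lemma path_from_hair:
  assumes fin: "finite S" and acyc: "\<nexists>c. is_cycle E S c" and E: "E \<subseteq> pairs V"
    and fs: "\<And>x. finite (Sec x)"
    and deg: "\<And>x. x \<in> S \<Longrightarrow> 2 \<le> card {w \<in> S. {x, w} \<in> E} + card (Sec x)"
    and x: "x \<in> S" "y \<in> Sec x"
  obtains xs z where "is_path E S xs" "hd xs = x" "z \<in> Sec (last xs)" "length xs = 1 \<Longrightarrow> z \<noteq> y"
proof (cases "\<exists>z\<in>Sec x. z \<noteq> y")
  case True
  then obtain z where "z \<in> Sec x" "z \<noteq> y" by blast
  moreover have "is_path E S [x]" using x by (simp add: is_path_def)
  ultimately show ?thesis using that[of "[x]" z] by auto
next
  case False
  then have "Sec x = {y}" using x by blast
  then have "card {w \<in> S. {x, w} \<in> E} \<noteq> 0" using deg[OF x(1)] by auto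
  then have "{w \<in> S. {x, w} \<in> E} \<noteq> {}" by (metis card.empty)
  then obtain w where w: "w \<in> S" "{x, w} \<in> E" by blast
  then have "w \<noteq> x" using E by (auto simp: pairs_def)
  then have p: "is_path E S [x, w]" using w x by (auto simp: is_path_def)
  have deg': "2 \<le> card {w \<in> S. {x, w} \<in> E} \<or> Sec x \<noteq> {}" if "x \<in> S" for x
    using deg[OF that] by (cases "Sec x = {}") auto
  have len2: "2 \<le> length [x, w]" by simp
  obtain ys where ys: "is_path E S ([x, w] @ ys)" "Sec (last ([x, w] @ ys)) \<noteq> {}"
    using extend_path[OF fin acyc E deg' p len2] by metis
  then obtain z where "z \<in> Sec (last ([x, w] @ ys))" by blast
  then show ?thesis using that[of "[x, w] @ ys" z] ys(1) by auto
qed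

lemma path_through:
  assumes fin: "finite S" and acyc: "\<nexists>c. is_cycle E S c" and E: "E \<subseteq> pairs V"
    and fs: "\<And>x. finite (Sec x)"
    and deg: "\<And>x. x \<in> S \<Longrightarrow> 2 \<le> card {w \<in> S. {x, w} \<in> E} + card (Sec x)"
    and x: "x \<in> S"
  obtains xs y z where "is_path E S xs" "x \<in> set xs" "y \<in> Sec (hd xs)" "z \<in> Sec (last xs)"
    "length xs = 1 \<Longrightarrow> y \<noteq> z"
proof (cases "Sec x = {}")
  case False
  then obtain y where y: "y \<in> Sec x" by blast
  obtain xs z where "is_path E S xs" "hd xs = x" "z \<in> Sec (last xs)" "length xs = 1 \<Longrightarrow> z \<noteq> y"
    using path_from_hair[OF fin acyc E fs deg x y] by metis
  then show ?thesis using that[of xs y z] y hd_in_set[of xs] unfolding is_path_def by metis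
next
  case True
  then have c: "2 \<le> card {w \<in> S. {x, w} \<in> E}" using deg[OF x] by simp
  then obtain a b where ab: "a \<noteq> b" "a \<in> S" "b \<in> S" "{x, a} \<in> E" "{x, b} \<in> E"
    using card_le_Suc0_iff_eq[of "{w \<in> S. {x, w} \<in> E}"] fin by fastforce
  then have "a \<noteq> x" "b \<noteq> x" using E by (auto simp: pairs_def)
  then have p: "is_path E S [a, x, b]" using ab x by (auto simp: is_path_def insert_commute)
  have deg': "2 \<le> card {w \<in> S. {x, w} \<in> E} \<or> Sec x \<noteq> {}" if "x \<in> S" for x
    using deg[OF that] by (cases "Sec x = {}") auto
  have len3: "2 \<le> length [a, x, b]" by simp
  obtain ys where ys: "is_path E S ([a, x, b] @ ys)" "Sec (last ([a, x, b] @ ys)) \<noteq> {}"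
    using extend_path[OF fin acyc E deg' p len3] by metis
  \<comment> \<open>One end is done; the reversed path is now extended at its other end.\<close>
  let ?ys = "rev ([a, x, b] @ ys)"
  have p2: "is_path E S ?ys" using ys(1) by (simp only: is_path_rev)
  have len4: "2 \<le> length ?ys" by simp
  obtain zs where zs: "is_path E S (?ys @ zs)" "Sec (last (?ys @ zs)) \<noteq> {}"
    using extend_path[OF fin acyc E deg' p2 len4] by metis
  have "hd (?ys @ zs) = last ([a, x, b] @ ys)"
    by (subst hd_append2) (simp_all add: hd_rev del: rev_append)
  then obtain y z where "y \<in> Sec (hd (?ys @ zs))" "z \<in> Sec (last (?ys @ zs))"
    using ys(2) zs(2) by (metis ex_in_conv)
  then show ?thesis using that[OF zs(1), of y z] by auto
qed

text \<open>
  The non-tree edges between vertices at distance at most \<open>q\<close> from \<open>v\<close>, each in both orientations.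
\<close>

definition chords :: "'a set set \<Rightarrow> 'a \<Rightarrow> nat \<Rightarrow> ('a \<times> 'a) set" where
  "chords E v q = {(x, y). x \<in> nball E v q \<and> y \<in> nball E v q \<and> {x, y} \<in> E - tree E v}"

text \<open>
  The paths in the layer at distance \<open>q + 1\<close> both of whose ends send a non-tree edge back into the
  ball of radius \<open>q\<close>, the two edges being different. The number \<open>i\<close> marks a position on the path,
  so that a path contributes once for each of its vertices.
\<close>

definition arms :: "'a set set \<Rightarrow> 'a \<Rightarrow> nat \<Rightarrow> ('a list \<times> nat \<times> 'a \<times> 'a) set" where
  "arms E v q = {(xs, i, y, z). is_path E (layer E v q) xs \<and> i < length xs \<and>
     y \<in> nball E v q \<and> z \<in> nball E v q \<and>
     {hd xs, y} \<in> E - tree E v \<and> {last xs, z} \<in> E - tree E v \<and> (length xs = 1 \<longrightarrow> y \<noteq> z)}"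

lemma finite_is_path: "finite S \<Longrightarrow> finite {xs. is_path E S xs}"
  by (rule finite_subset[OF _ finite_subset_distinct[of S]]) (auto simp: is_path_def)

lemma card_ordered_le:
  assumes "finite F" "\<And>x y. (x, y) \<in> P \<Longrightarrow> {x, y} \<in> F"
  shows "card P \<le> 2 * card F"
proof -
  have "card {p. {fst p, snd p} = e} \<le> 2 \<and> finite {p. {fst p, snd p} = e}" for e :: "'a set"
  proof (cases "\<exists>a b. e = {a, b}")
    case True
    then obtain a b where "e = {a, b}" by blast
    then have s: "{p. {fst p, snd p} = e} \<subseteq> {(a, b), (b, a)}"
      by (auto simp: doubleton_eq_iff)
    then have "card {p. {fst p, snd p} = e} \<le> card {(a, b), (b, a)}" by (intro card_mono) auto
    also have "\<dots> \<le> 2" by (cases "a = b") auto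
    finally show ?thesis using finite_subset[OF s] by auto
  next
    case False
    then have "{p. {fst p, snd p} = e} = {}" by auto
    then show ?thesis by simp
  qed
  then have *: "\<And>e :: 'a set. card {p. {fst p, snd p} = e} \<le> 2"
    "\<And>e :: 'a set. finite {p. {fst p, snd p} = e}" by auto
  have "P \<subseteq> (\<Union>e\<in>F. {p. {fst p, snd p} = e})" using assms(2) by auto
  then have "card P \<le> card (\<Union>e\<in>F. {p. {fst p, snd p} = e})"
    by (intro card_mono) (use assms(1) * in auto)
  also have "\<dots> \<le> (\<Sum>e\<in>F. card {p. {fst p, snd p} = e})" by (rule card_UN_le) fact
  also have "\<dots> \<le> (\<Sum>e\<in>F. 2)" by (intro sum_mono *)
  finally show ?thesis by (simp add: mult.commute)
qed

lemma finite_arms: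
  assumes "finite V" "E \<subseteq> pairs V" "v \<in> V"
  shows "finite (arms E v q)"
proof -
  have *: "nball E v i \<subseteq> V" for i by (rule nball_subset[OF assms(2,3)])
  have l: "layer E v q \<subseteq> V" unfolding layer_def using * by blast
  have "arms E v q \<subseteq> {xs. is_path E V xs} \<times> {..card V} \<times> V \<times> V"
  proof
    fix t assume t: "t \<in> arms E v q"
    obtain xs i y z where [simp]: "t = (xs, i, y, z)" by (cases t)
    have xs: "is_path E V xs" using t l by (auto simp: arms_def is_path_def)
    then have "length xs \<le> card V"
      using card_mono[OF assms(1), of "set xs"] distinct_card[of xs] by (auto simp: is_path_def)
    then show "t \<in> {xs. is_path E V xs} \<times> {..card V} \<times> V \<times> V"
      using t xs * by (auto simp: arms_def)
  qed
  moreover have "finite ({xs. is_path E V xs} \<times> {..card V} \<times> V \<times> V)"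
    by (intro finite_cartesian_product finite_is_path assms(1) finite_atMost)
  ultimately show ?thesis by (rule finite_subset)
qed

lemma finite_chords:
  assumes "finite V" "E \<subseteq> pairs V" "v \<in> V"
  shows "finite (chords E v q)"
proof (rule finite_subset)
  show "chords E v q \<subseteq> V \<times> V"
    using nball_subset[OF assms(2,3), of q] by (auto simp: chords_def)
qed (use assms(1) in simp)

text \<open>
  The combinatorial core. Let \<open>H\<close> be a set of vertices of minimum degree at least 3 in the ball of
  radius \<open>q + 1\<close>, let \<open>S\<close> be its part in the outermost layer and \<open>A\<close> the rest. A vertex of \<open>S\<close>
  is incident with at most one tree edge to \<open>A\<close>, so it has at least two edges that run inside \<open>S\<close>
  or are non-tree edges to \<open>A\<close>. If the outermost layer has no cycle, then by the lemmas above
  \<open>S\<close>, and also the set of non-tree edges between \<open>S\<close> and \<open>A\<close>, has at most as many elements as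
  \<open>arms\<close>. Counting degrees in \<open>A\<close> then bounds \<open>card A\<close>, since there are at most \<open>card A\<close>
  tree edges inside \<open>A\<close>.
\<close>

lemma min_degree_3_card_le:
  assumes V: "finite V" "E \<subseteq> pairs V" "v \<in> V"
    and H: "H \<subseteq> nball E v (Suc q)" "\<And>x. x \<in> H \<Longrightarrow> 3 \<le> card {w \<in> H. {x, w} \<in> E}"
    and acyc: "\<nexists>c. is_cycle E (layer E v q) c"
  shows "card H \<le> card (chords E v q) + 3 * card (arms E v q)"
proof -
  define S where "S = H \<inter> layer E v q"
  define A where "A = H \<inter> nball E v q"
  define Sec where "Sec x = {y \<in> A. {x, y} \<in> E - tree E v}" for x
  have finH: "finite H"
    using finite_subset[OF H(1)] finite_subset[OF nball_subset[OF V(2,3)] V(1)] by blast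
  have HSA: "H = S \<union> A" "S \<inter> A = {}" using H(1) by (auto simp: S_def A_def layer_def)
  have fin: "finite S" "finite A" using finH by (auto simp: S_def A_def)
  have fs: "finite (Sec x)" for x using fin by (auto simp: Sec_def)
  have SL: "S \<subseteq> layer E v q" and AI: "A \<subseteq> nball E v q" by (auto simp: S_def A_def)
  have acycS: "\<nexists>c. is_cycle E S c"
    using acyc SL by (fastforce simp: is_cycle_def is_path_def)
  have to_A: "y = parent E v x \<or> y \<in> Sec x" if "x \<in> S" "y \<in> A" "{x, y} \<in> E" for x y
    using tree_to_ball[of x E v q y] that SL AI by (auto simp: Sec_def)
  \<comment> \<open>Tree edges join a vertex of \<open>S\<close> to no vertex of \<open>A\<close> but its parent.\<close>
  have deg: "2 \<le> card {w \<in> S. {x, w} \<in> E} + card (Sec x)" if x: "x \<in> S" for x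
  proof -
    have "{w \<in> H. {x, w} \<in> E} \<subseteq> {w \<in> S. {x, w} \<in> E} \<union> insert (parent E v x) (Sec x)"
      using to_A[OF x] HSA(1) by auto
    then have "card {w \<in> H. {x, w} \<in> E} \<le>
        card ({w \<in> S. {x, w} \<in> E} \<union> insert (parent E v x) (Sec x))"
      by (intro card_mono) (use fin fs in auto)
    also have "\<dots> \<le> card {w \<in> S. {x, w} \<in> E} + card (insert (parent E v x) (Sec x))"
      by (rule card_Un_le)
    also have "\<dots> \<le> card {w \<in> S. {x, w} \<in> E} + Suc (card (Sec x))"
      using card_insert_le_m1[of "Suc (card (Sec x))" "Sec x" "parent E v x"] by simp
    finally show ?thesis using H(2)[of x] x HSA(1) by auto
  qed
  have arm: "(xs, i, y, z) \<in> arms E v q"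
    if "is_path E S xs" "y \<in> Sec (hd xs)" "z \<in> Sec (last xs)" "length xs = 1 \<Longrightarrow> y \<noteq> z" "i < length xs"
    for xs i y z
    using that SL AI unfolding arms_def Sec_def is_path_def by blast
  have S_le: "card S \<le> card (arms E v q)"
  proof (rule surj_card_le[OF finite_arms[OF V], of _ "\<lambda>(xs, i, y, z). xs ! i"], rule subsetI)
    fix x assume x: "x \<in> S"
    obtain xs y z where xs: "is_path E S xs" "x \<in> set xs" "y \<in> Sec (hd xs)" "z \<in> Sec (last xs)"
      "length xs = 1 \<Longrightarrow> y \<noteq> z"
      using path_through[OF fin(1) acycS V(2) fs deg x] by metis
    obtain i where "i < length xs" "xs ! i = x" using xs(2) by (auto simp: in_set_conv_nth)
    then show "x \<in> (\<lambda>(xs, i, y, z). xs ! i) ` arms E v q"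
      using arm[OF xs(1,3,4,5)] by force
  qed
  have Sec_le: "card (Sigma S Sec) \<le> card (arms E v q)"
  proof (rule surj_card_le[OF finite_arms[OF V], of _ "\<lambda>(xs, i, y, z). (hd xs, y)"], rule subsetI)
    fix p assume p: "p \<in> Sigma S Sec"
    obtain x y where xy: "p = (x, y)" "x \<in> S" "y \<in> Sec x" using p by auto
    obtain xs z where xs: "is_path E S xs" "hd xs = x" "z \<in> Sec (last xs)" "length xs = 1 \<Longrightarrow> z \<noteq> y"
      using path_from_hair[OF fin(1) acycS V(2) fs deg xy(2,3)] by metis
    then have "(xs, 0, y, z) \<in> arms E v q"
      using xy by (intro arm) (auto simp: is_path_def)
    then show "p \<in> (\<lambda>(xs, i, y, z). (hd xs, y)) ` arms E v q"
      using xs xy by force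
  qed
  have "3 * card A \<le> (\<Sum>x\<in>A. card {w \<in> H. {x, w} \<in> E})"
    using sum_mono[of A "\<lambda>_. 3" "\<lambda>x. card {w \<in> H. {x, w} \<in> E}"] H(2) HSA(1) by (simp add: mult.commute)
  also have "\<dots> = (\<Sum>x\<in>A. card {w \<in> A. {x, w} \<in> E} + card {w \<in> S. {x, w} \<in> E})"
  proof (rule sum.cong[OF refl])
    fix x
    have "{w \<in> H. {x, w} \<in> E} = {w \<in> A. {x, w} \<in> E} \<union> {w \<in> S. {x, w} \<in> E}"
      using HSA by auto
    then show "card {w \<in> H. {x, w} \<in> E} = card {w \<in> A. {x, w} \<in> E} + card {w \<in> S. {x, w} \<in> E}"
      using fin HSA(2) by (subst card_Un_disjoint[symmetric]) auto
  qed
  also have "\<dots> = card (SIGMA x:A. {w \<in> A. {x, w} \<in> E}) + card (SIGMA x:A. {w \<in> S. {x, w} \<in> E})"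
    using fin by (simp add: sum.distrib)
  finally have A3: "3 * card A \<le> \<dots>" .
  have "card (SIGMA x:A. {w \<in> A. {x, w} \<in> E}) \<le>
      card (chords E v q \<union> (SIGMA x:A. {w \<in> A. {x, w} \<in> tree E v}))"
    by (intro card_mono) (use AI fin finite_chords[OF V] in \<open>auto simp: chords_def\<close>)
  also have "\<dots> \<le> card (chords E v q) + card (SIGMA x:A. {w \<in> A. {x, w} \<in> tree E v})"
    by (rule card_Un_le)
  also have "card (SIGMA x:A. {w \<in> A. {x, w} \<in> tree E v}) \<le> 2 * card ((\<lambda>y. {y, parent E v y}) ` A)"
  proof (rule card_ordered_le)
    fix x y assume "(x, y) \<in> (SIGMA x:A. {w \<in> A. {x, w} \<in> tree E v})"
    then have xy: "x \<in> A" "y \<in> A" "{x, y} \<in> tree E v" by auto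
    then obtain y' where y': "{x, y} = {y', parent E v y'}" unfolding tree_def by blast
    have "y' \<in> {x, y}" unfolding y' by simp
    then have "y' \<in> A" using xy by blast
    then show "{x, y} \<in> (\<lambda>y. {y, parent E v y}) ` A"
      unfolding y' by (rule imageI)
  qed (use fin in auto)
  also have "\<dots> \<le> 2 * card A" using card_image_le[OF fin(2)] by simp
  finally have a: "card (SIGMA x:A. {w \<in> A. {x, w} \<in> E}) \<le> card (chords E v q) + 2 * card A" by simp
  have "card (SIGMA x:A. {w \<in> S. {x, w} \<in> E}) \<le>
      card ((\<lambda>w. (parent E v w, w)) ` S \<union> prod.swap ` Sigma S Sec)"
  proof (rule card_mono)
    show "(SIGMA x:A. {w \<in> S. {x, w} \<in> E}) \<subseteq> (\<lambda>w. (parent E v w, w)) ` S \<union> prod.swap ` Sigma S Sec"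
    proof
      fix p assume "p \<in> (SIGMA x:A. {w \<in> S. {x, w} \<in> E})"
      then obtain x w where p: "p = (x, w)" "x \<in> A" "w \<in> S" "{w, x} \<in> E"
        by (auto simp: insert_commute)
      from to_A[OF p(3,2,4)]
      show "p \<in> (\<lambda>w. (parent E v w, w)) ` S \<union> prod.swap ` Sigma S Sec"
      proof
        assume "x \<in> Sec w"
        then have "prod.swap (w, x) \<in> prod.swap ` Sigma S Sec" using p(3) by (intro imageI) auto
        then show ?thesis using p(1) by simp
      qed (use p in auto)
    qed
  qed (use fin fs in auto)
  also have "\<dots> \<le> card ((\<lambda>w. (parent E v w, w)) ` S) + card (prod.swap ` Sigma S Sec)"
    by (rule card_Un_le)
  also have "\<dots> \<le> card S + card (Sigma S Sec)"
    by (intro add_mono card_image_le) (use fin fs in auto)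
  finally have b: "card (SIGMA x:A. {w \<in> S. {x, w} \<in> E}) \<le> card S + card (Sigma S Sec)" .
  have "card A \<le> card (chords E v q) + card S + card (Sigma S Sec)"
    using A3 a b by linarith
  moreover have "card H = card S + card A"
    unfolding HSA(1) by (rule card_Un_disjoint) (use fin HSA in auto)
  ultimately show ?thesis using S_le Sec_le by linarith
qed

lemma min_degree_3_dense:
  assumes "finite H" "E \<subseteq> pairs V" "\<And>x. x \<in> H \<Longrightarrow> 3 \<le> card {w \<in> H. {x, w} \<in> E}"
  shows "3 * card H \<le> 2 * card (E \<inter> pairs H)"
proof -
  have "3 * card H \<le> (\<Sum>x\<in>H. card {w \<in> H. {x, w} \<in> E})"
    using sum_mono[of H "\<lambda>_. 3" "\<lambda>x. card {w \<in> H. {x, w} \<in> E}"] assms(3) by (simp add: mult.commute)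
  also have "\<dots> = card (SIGMA x:H. {w \<in> H. {x, w} \<in> E})"
    using assms(1) by simp
  also have "\<dots> \<le> 2 * card (E \<inter> pairs H)"
    by (rule card_ordered_le) (use assms(1,2) in \<open>auto simp: finite_pairs, auto simp: pairs_def\<close>)
  finally show ?thesis .
qed

lemma min_degree_3_card_ge_4:
  assumes "finite H" "E \<subseteq> pairs V" "x \<in> H" "3 \<le> card {w \<in> H. {x, w} \<in> E}"
  shows "4 \<le> card H"
proof -
  have "x \<notin> {w \<in> H. {x, w} \<in> E}" using assms(2) by (auto simp: pairs_def)
  then have "card (insert x {w \<in> H. {x, w} \<in> E}) = Suc (card {w \<in> H. {x, w} \<in> E})"
    using assms(1) by (intro card_insert_disjoint) auto
  moreover have "card (insert x {w \<in> H. {x, w} \<in> E}) \<le> card H"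
    using assms by (intro card_mono) auto
  ultimately show ?thesis using assms(4) by linarith
qed

text \<open>
  The subgraph induced on \<open>B\<close> has a proper coloring with \<open>k\<close> colors.
\<close>

definition colorable_on :: "'a set set \<Rightarrow> nat \<Rightarrow> 'a set \<Rightarrow> bool" where
  "colorable_on E k B \<longleftrightarrow>
     (\<exists>f. (\<forall>x\<in>B. f x < k) \<and> (\<forall>x\<in>B. \<forall>y\<in>B. {x, y} \<in> E \<longrightarrow> f x \<noteq> f y))"

lemma colorable_on_mono:
  assumes "colorable_on E k B" "E' \<subseteq> E" "B' \<subseteq> B"
  shows "colorable_on E' k B'"
proof -
  obtain f where "\<forall>x\<in>B. f x < k" "\<forall>x\<in>B. \<forall>y\<in>B. {x, y} \<in> E \<longrightarrow> f x \<noteq> f y"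
    using assms(1) unfolding colorable_on_def by blast
  then have "(\<forall>x\<in>B'. f x < k) \<and> (\<forall>x\<in>B'. \<forall>y\<in>B'. {x, y} \<in> E' \<longrightarrow> f x \<noteq> f y)"
    using assms(2,3) by (simp add: subset_iff)
  then show ?thesis unfolding colorable_on_def by blast
qed

lemma colorable_on_if_degenerate:
  assumes "finite B" "E \<subseteq> pairs V"
    and "\<And>H. H \<subseteq> B \<Longrightarrow> H \<noteq> {} \<Longrightarrow> \<exists>x\<in>H. card {w \<in> H. {x, w} \<in> E} < k"
  shows "colorable_on E k B"
  using assms(1,3)
proof (induction "card B" arbitrary: B)
  case 0
  then show ?case by (simp add: colorable_on_def)
next
  case (Suc m)
  then have "B \<noteq> {}" by auto
  then obtain x where x: "x \<in> B" "card {w \<in> B. {x, w} \<in> E} < k" using Suc.prems(2) by blast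
  have "colorable_on E k (B - {x})"
  proof (rule Suc.hyps(1))
    show "m = card (B - {x})" using Suc.hyps(2) Suc.prems(1) x(1) by simp
  qed (use Suc.prems in auto)
  then obtain f where f: "\<forall>y\<in>B - {x}. f y < k"
    "\<forall>y\<in>B - {x}. \<forall>z\<in>B - {x}. {y, z} \<in> E \<longrightarrow> f y \<noteq> f z"
    unfolding colorable_on_def by blast
  have "card (f ` {w \<in> B. {x, w} \<in> E}) < k"
    using card_image_le[of "{w \<in> B. {x, w} \<in> E}" f] x Suc.prems(1) by auto
  then have "\<not> {..<k} \<subseteq> f ` {w \<in> B. {x, w} \<in> E}"
    using card_mono[of "f ` {w \<in> B. {x, w} \<in> E}" "{..<k}"] Suc.prems(1) by auto
  then obtain c where c: "c < k" "c \<notin> f ` {w \<in> B. {x, w} \<in> E}" by blast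
  have "{x, x} \<notin> E" using assms(2) by (auto simp: pairs_def)
  then have "\<forall>y\<in>B. \<forall>z\<in>B. {y, z} \<in> E \<longrightarrow> (f(x := c)) y \<noteq> (f(x := c)) z"
    using f(2) c(2) by (auto simp: insert_commute)
  then show ?case using f(1) c(1) unfolding colorable_on_def by (intro exI[of _ "f(x := c)"]) auto
qed

section \<open>First moments in the ball of a fixed vertex\<close>

text \<open>
  First moment bound. The sets \<open>St E\<close> consist of the structures \<open>t\<close> to be counted, each of which
  contains a set \<open>X t\<close> of \<open>k t\<close> edges. If the deletion of these edges leaves \<open>t\<close> a candidate,
  then the expected number of structures is at most the largest total weight of the candidates in
  a fixed graph, where every edge of \<open>X t\<close> contributes a factor \<open>p / (1 - p)\<close>.
\<close>

lemma expect_count_le: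
  assumes p: "0 \<le> p" "p < 1" and U: "finite U" and T: "finite T" and b: "0 \<le> b"
    and St: "\<And>E t. E \<subseteq> U \<Longrightarrow> ok E \<Longrightarrow> t \<in> St E \<Longrightarrow>
      t \<in> T \<and> X t \<subseteq> E \<and> card (X t) = k t \<and> ok (E - X t) \<and> t \<in> Cand (E - X t)"
    and sum: "\<And>E. E \<subseteq> U \<Longrightarrow> ok E \<Longrightarrow> (\<Sum>t\<in>T \<inter> Cand E. (p / (1 - p)) ^ k t) \<le> b"
  shows "expect p U (\<lambda>E. of_bool (ok E) * real (card (St E))) \<le> b"
proof -
  let ?r = "p / (1 - p)"
  have r: "0 \<le> ?r" using p by simp
  have le1: "p \<le> 1" using p by simp
  have one: "prob p U (\<lambda>E. ok E \<and> t \<in> St E) \<le> ?r ^ k t * prob p U (\<lambda>E. ok E \<and> t \<in> Cand E)" for t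
  proof (cases "\<exists>E\<subseteq>U. ok E \<and> t \<in> St E")
    case True
    then have X: "X t \<subseteq> U" "card (X t) = k t" using St by blast+
    have "prob p U (\<lambda>E. ok E \<and> t \<in> St E) \<le> prob p U (\<lambda>E. X t \<subseteq> E \<and> ok E \<and> t \<in> St E)"
      using St by (intro prob_mono p(1) le1) blast
    also have "\<dots> \<le> ?r ^ card (X t) * prob p U (\<lambda>E. ok E \<and> t \<in> Cand E)"
      using St by (intro prob_contains_le p U X(1)) blast
    finally show ?thesis by (simp add: X(2))
  next
    case False
    then have "prob p U (\<lambda>E. ok E \<and> t \<in> St E) \<le> prob p U (\<lambda>_. False)"
      by (intro prob_mono p(1) le1) blast
    also have "\<dots> = 0" by (simp add: prob_def expect_def)
    also have "0 \<le> ?r ^ k t * expect p U (\<lambda>E. of_bool (ok E \<and> t \<in> Cand E))"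
      using expect_mono[OF p(1) le1, of U "\<lambda>_. 0" "\<lambda>E. of_bool (ok E \<and> t \<in> Cand E)"] r
      by (intro mult_nonneg_nonneg zero_le_power) (auto simp: expect_const[OF U])
    finally show ?thesis by (simp add: prob_def)
  qed
  have "expect p U (\<lambda>E. of_bool (ok E) * real (card (St E))) \<le>
      expect p U (\<lambda>E. \<Sum>t\<in>T. of_bool (ok E \<and> t \<in> St E))"
  proof (intro expect_mono p(1) le1)
    fix E assume E: "E \<subseteq> U"
    show "of_bool (ok E) * real (card (St E)) \<le> (\<Sum>t\<in>T. of_bool (ok E \<and> t \<in> St E))"
    proof (cases "ok E")
      case True
      then have "St E \<subseteq> T" using St[OF E] by blast
      then have "T \<inter> {t. t \<in> St E} = St E" by blast
      then show ?thesis using True T by (simp flip: sum.inter_filter)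
    qed simp
  qed
  also have "\<dots> = (\<Sum>t\<in>T. prob p U (\<lambda>E. ok E \<and> t \<in> St E))"
    by (simp add: expect_sum prob_def)
  also have "\<dots> \<le> (\<Sum>t\<in>T. ?r ^ k t * prob p U (\<lambda>E. ok E \<and> t \<in> Cand E))"
    by (intro sum_mono one)
  also have "\<dots> = expect p U (\<lambda>E. \<Sum>t\<in>T. ?r ^ k t * of_bool (ok E \<and> t \<in> Cand E))"
    by (simp only: prob_def expect_sum expect_cmult)
  also have "\<dots> \<le> expect p U (\<lambda>_. b)"
  proof (intro expect_mono p(1) le1)
    fix E assume E: "E \<subseteq> U"
    show "(\<Sum>t\<in>T. ?r ^ k t * of_bool (ok E \<and> t \<in> Cand E)) \<le> b"
    proof (cases "ok E")
      case True
      have "(\<Sum>t\<in>T. ?r ^ k t * of_bool (ok E \<and> t \<in> Cand E)) = (\<Sum>t\<in>T. if t \<in> Cand E then ?r ^ k t else 0)"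
        using True by (intro sum.cong) auto
      also have "\<dots> = (\<Sum>t\<in>T \<inter> Cand E. ?r ^ k t)"
        using T by (rule sum.inter_restrict[symmetric])
      finally show ?thesis using sum[OF E True] by simp
    qed (simp add: b)
  qed
  also have "\<dots> = b" by (rule expect_const[OF U])
  finally show ?thesis .
qed

lemma sum_geometric_le:
  fixes z :: real
  assumes "0 \<le> z" "z < 1"
  shows "(\<Sum>i<m. z ^ i) \<le> 1 / (1 - z)"
  using sum_le_suminf[of "\<lambda>i. z ^ i" "{..<m}"] assms
  by (simp add: summable_geometric suminf_geometric)

lemma sum_power_from_3_le:
  fixes z :: real
  assumes "0 \<le> z" "z < 1"
  shows "(\<Sum>j\<in>{3..m}. z ^ j) \<le> z ^ 3 / (1 - z)"
proof -
  have "(\<Sum>j\<in>{3..m}. z ^ j) \<le> (\<Sum>j\<in>(\<lambda>i. i + 3) ` {..<m}. z ^ j)"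
  proof (intro sum_mono2)
    show "{3..m} \<subseteq> (\<lambda>i. i + 3) ` {..<m}"
    proof
      fix j assume "j \<in> {3..m}"
      then have "j = (j - 3) + 3" "j - 3 \<in> {..<m}" by auto
      then show "j \<in> (\<lambda>i. i + 3) ` {..<m}" by (rule image_eqI)
    qed
  qed (use assms in auto)
  also have "\<dots> = z ^ 3 * (\<Sum>i<m. z ^ i)"
    by (subst sum.reindex) (auto simp: power_add sum_distrib_right mult.commute)
  also have "\<dots> \<le> z ^ 3 * (1 / (1 - z))"
    using assms by (intro mult_left_mono sum_geometric_le) auto
  finally show ?thesis by simp
qed

lemma sum_arith_geometric_le:
  fixes z :: real
  assumes "0 \<le> z" "z < 1"
  shows "(\<Sum>j\<le>m. real j * z ^ j) \<le> z / (1 - z)\<^sup>2"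
proof -
  have s: "(\<lambda>n. of_nat (Suc n) * z ^ n) sums (1 / (1 - z)\<^sup>2)"
    using assms by (intro geometric_deriv_sums) auto
  have "(\<Sum>j\<le>m. real j * z ^ j) = (\<Sum>i<m. real (Suc i) * z ^ Suc i)"
    by (subst sum.atMost_shift) simp
  also have "\<dots> = z * (\<Sum>i<m. of_nat (Suc i) * z ^ i)"
    by (simp add: sum_distrib_left mult_ac)
  also have "\<dots> \<le> z * (1 / (1 - z)\<^sup>2)"
    using assms sum_le_suminf[OF sums_summable[OF s], of "{..<m}"] sums_unique[OF s]
    by (intro mult_left_mono) auto
  finally show ?thesis by simp
qed

lemma closing_edge_not_in_path:
  assumes "distinct xs" "3 \<le> length xs"
  shows "{last xs, hd xs} \<notin> path_edges xs"
proof -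
  obtain x y z zs where xs: "xs = x # y # z # zs"
    using assms(2) by (auto simp: numeral_3_eq_3 Suc_le_length_iff)
  have "{last xs, hd xs} \<noteq> {x, y}"
    using assms(1) last_in_set[of "z # zs"] unfolding xs by (auto simp: doubleton_eq_iff)
  moreover have "{last xs, hd xs} \<notin> path_edges (y # z # zs)"
    using path_edges_subset[of "{last xs, hd xs}" "y # z # zs"] assms(1) unfolding xs by auto
  ultimately show ?thesis unfolding xs by simp
qed

text \<open>
  A vertex \<open>v\<close> of the random graph on \<open>V\<close>, and the bounds \<open>R\<close> and \<open>Q\<close> for the sizes of the
  outermost layer and of the inner part of its ball of radius \<open>q + 1\<close>.
\<close>

locale exposed_vertex =
  fixes V :: "'a set" and v :: 'a and q :: nat and p R Q :: real
  assumes finV: "finite V" and vV: "v \<in> V" and p: "0 \<le> p" "p < 1" and RQ: "0 \<le> R" "0 \<le> Q"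
begin

text \<open>
  The ball of radius \<open>q + 1\<close> about \<open>v\<close> is not larger than prescribed. By \<open>nball_eq_of_tree\<close> this event is
  not affected when non-tree edges are deleted.
\<close>

definition ok :: "'a set set \<Rightarrow> bool" where
  "ok E \<longleftrightarrow> real (card (layer E v q)) \<le> R \<and> real (card (nball E v q)) \<le> Q"

abbreviation odds :: real where "odds \<equiv> p / (1 - p)"

lemma odds_nonneg: "0 \<le> odds" using p by simp

lemma R_odds_nonneg: "0 \<le> R * odds" using RQ(1) odds_nonneg by (rule mult_nonneg_nonneg)

lemma finite_parts:
  assumes "E \<subseteq> pairs V"
  shows "nball E v i \<subseteq> V" "layer E v i \<subseteq> V" "finite (nball E v i)" "finite (layer E v i)"
  using nball_subset[OF assms vV] finite_subset[OF _ finV] unfolding layer_def by blast+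

lemma remove_edges:
  assumes "X \<subseteq> E" "X \<inter> tree E v = {}"
  shows "nball (E - X) v i = nball E v i" "layer (E - X) v i = layer E v i" "ok (E - X) = ok E"
proof -
  have "tree E v \<subseteq> E - X" "E - X \<subseteq> E" using assms tree_subset[of E v] by auto
  from nball_eq_of_tree[OF this] layer_eq_of_tree[OF this]
  show "nball (E - X) v i = nball E v i" "layer (E - X) v i = layer E v i" "ok (E - X) = ok E"
    by (auto simp: ok_def)
qed

lemma expect_chords:
  "expect p (pairs V) (\<lambda>E. of_bool (ok E) * real (card (chords E v q))) \<le> Q\<^sup>2 * odds"
proof (rule expect_count_le[where T = "V \<times> V" and X = "\<lambda>(x, y). {{x, y}}" and k = "\<lambda>_. 1"
      and Cand = "\<lambda>E. nball E v q \<times> nball E v q"])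
  fix E t assume E: "E \<subseteq> pairs V" "ok E" and t: "t \<in> chords E v q"
  obtain x y where t': "t = (x, y)" by (cases t)
  have X: "{{x, y}} \<subseteq> E" "{{x, y}} \<inter> tree E v = {}" using t t' by (auto simp: chords_def)
  show "t \<in> V \<times> V \<and> (case t of (x, y) \<Rightarrow> {{x, y}}) \<subseteq> E \<and>
      card (case t of (x, y) \<Rightarrow> {{x, y}}) = 1 \<and> ok (E - (case t of (x, y) \<Rightarrow> {{x, y}})) \<and>
      t \<in> nball (E - (case t of (x, y) \<Rightarrow> {{x, y}})) v q \<times> nball (E - (case t of (x, y) \<Rightarrow> {{x, y}})) v q"
    using t E X finite_parts[OF E(1), of q] unfolding t' by (auto simp: remove_edges[OF X] chords_def)
next
  fix E assume E: "E \<subseteq> pairs V" "ok E"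
  have "V \<times> V \<inter> nball E v q \<times> nball E v q = nball E v q \<times> nball E v q"
    using finite_parts[OF E(1)] by blast
  then have "(\<Sum>t\<in>V \<times> V \<inter> nball E v q \<times> nball E v q. odds ^ 1) = (real (card (nball E v q)))\<^sup>2 * odds"
    by (simp add: card_cartesian_product power2_eq_square)
  also have "\<dots> \<le> Q\<^sup>2 * odds"
    using E(2) odds_nonneg unfolding ok_def by (intro mult_right_mono power_mono) auto
  finally show "(\<Sum>t\<in>V \<times> V \<inter> nball E v q \<times> nball E v q. odds ^ 1) \<le> Q\<^sup>2 * odds" .
qed (use p finV odds_nonneg in \<open>auto simp: finite_pairs\<close>)

text \<open>
  The edges of an arm: those of the path and the two edges at its ends.
\<close>

definition arm_edges :: "'a list \<times> nat \<times> 'a \<times> 'a \<Rightarrow> 'a set set" where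
  "arm_edges = (\<lambda>(xs, i, y, z). insert {hd xs, y} (insert {last xs, z} (path_edges xs)))"

lemma arm_edges:
  assumes "(xs, i, y, z) \<in> arms E v q"
  shows "arm_edges (xs, i, y, z) \<subseteq> E" "arm_edges (xs, i, y, z) \<inter> tree E v = {}"
    "card (arm_edges (xs, i, y, z)) = length xs + 1"
proof -
  have a: "xs \<noteq> []" "distinct xs" "set xs \<subseteq> layer E v q" "path_edges xs \<subseteq> E"
    "y \<in> nball E v q" "z \<in> nball E v q" "{hd xs, y} \<in> E - tree E v" "{last xs, z} \<in> E - tree E v"
    "length xs = 1 \<longrightarrow> y \<noteq> z"
    using assms by (auto simp: arms_def is_path_def)
  have yz: "y \<notin> set xs" "z \<notin> set xs" using a(3,5,6) by (auto simp: layer_def)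
  show "arm_edges (xs, i, y, z) \<subseteq> E" using a by (auto simp: arm_edges_def)
  have "e \<notin> tree E v" if e: "e \<in> path_edges xs" for e
  proof -
    have "e \<in> pairs (set xs)" using path_edges_pairs[OF a(2)] e by blast
    then obtain u w where "e = {u, w}" "u \<in> set xs" "w \<in> set xs"
      unfolding pairs_def card_2_iff by auto
    then show ?thesis using tree_not_in_layer[of u E v q w] a(3) by auto
  qed
  then show "arm_edges (xs, i, y, z) \<inter> tree E v = {}" using a by (auto simp: arm_edges_def)
  have 1: "{hd xs, y} \<notin> path_edges xs" "{last xs, z} \<notin> path_edges xs"
    using path_edges_subset[of "{hd xs, y}" xs] path_edges_subset[of "{last xs, z}" xs] yz by auto
  have 2: "{hd xs, y} \<noteq> {last xs, z}"
  proof (cases "length xs = 1")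
    case True
    then obtain x where "xs = [x]" by (cases xs) auto
    then show ?thesis using a(9) yz by (auto simp: doubleton_eq_iff)
  next
    case False
    then have "hd xs \<noteq> last xs" using a(1,2) by (cases xs) auto
    then show ?thesis using yz a(1) hd_in_set[OF a(1)] by (auto simp: doubleton_eq_iff)
  qed
  have "card (arm_edges (xs, i, y, z)) = Suc (Suc (length xs - 1))"
    using 1 2 by (simp add: arm_edges_def card_path_edges[OF a(2)])
  also have "\<dots> = length xs + 1" using a(1) by (cases xs) auto
  finally show "card (arm_edges (xs, i, y, z)) = length xs + 1" .
qed

text \<open>
  There are at most \<open>R ^ j * j * Q\<^sup>2\<close> candidates with a path on \<open>j\<close> vertices, and each has \<open>j + 1\<close>
  edges.
\<close>

lemma expect_arms:
  assumes small: "R * odds < 1"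
  shows "expect p (pairs V) (\<lambda>E. of_bool (ok E) * real (card (arms E v q))) \<le>
    Q\<^sup>2 * odds * (R * odds / (1 - R * odds)\<^sup>2)"
proof (rule expect_count_le[where T = "{(xs, i, y, z). set xs \<subseteq> V \<and> length xs \<le> card V \<and> i < card V \<and> y \<in> V \<and> z \<in> V}"
      and X = arm_edges and k = "\<lambda>(xs, i, y, z). length xs + 1"
      and Cand = "\<lambda>E. {(xs, i, y, z). set xs \<subseteq> layer E v q \<and> i < length xs \<and> y \<in> nball E v q \<and> z \<in> nball E v q}"])
  have "{(xs, i, y, z). set xs \<subseteq> V \<and> length xs \<le> card V \<and> i < card V \<and> y \<in> V \<and> z \<in> V} =
      {xs. set xs \<subseteq> V \<and> length xs \<le> card V} \<times> {..<card V} \<times> V \<times> V" by auto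
  then show "finite {(xs, i, y, z). set xs \<subseteq> V \<and> length xs \<le> card V \<and> i < card V \<and> y \<in> V \<and> z \<in> V}"
    using finite_lists_length_le[OF finV] finV by auto
next
  fix E t assume E: "E \<subseteq> pairs V" "ok E" and t: "t \<in> arms E v q"
  obtain xs i y z where t': "t = (xs, i, y, z)" by (cases t)
  note X = arm_edges[OF t[unfolded t']]
  have a: "distinct xs" "set xs \<subseteq> layer E v q" "y \<in> nball E v q" "z \<in> nball E v q" "i < length xs"
    using t by (auto simp: t' arms_def is_path_def)
  then have V: "set xs \<subseteq> V" "y \<in> V" "z \<in> V" using finite_parts[OF E(1)] by blast+
  then have "length xs \<le> card V" using card_mono[OF finV V(1)] distinct_card[OF a(1)] by simp
  then show "t \<in> {(xs, i, y, z). set xs \<subseteq> V \<and> length xs \<le> card V \<and> i < card V \<and> y \<in> V \<and> z \<in> V} \<and>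
       arm_edges t \<subseteq> E \<and> card (arm_edges t) = (case t of (xs, i, y, z) \<Rightarrow> length xs + 1) \<and>
       ok (E - arm_edges t) \<and>
       t \<in> {(xs, i, y, z). set xs \<subseteq> layer (E - arm_edges t) v q \<and> i < length xs \<and>
             y \<in> nball (E - arm_edges t) v q \<and> z \<in> nball (E - arm_edges t) v q}"
    using X a V E unfolding t' by (simp add: remove_edges[OF X(1,2)])
next
  fix E assume E: "E \<subseteq> pairs V" "ok E"
  let ?T = "{(xs, i, y, z). set xs \<subseteq> V \<and> length xs \<le> card V \<and> i < card V \<and> y \<in> V \<and> z \<in> V}"
  let ?C = "{(xs, i, y, z). set xs \<subseteq> layer E v q \<and> i < length xs \<and> y \<in> nball E v q \<and> z \<in> nball E v q}"
  let ?B = "\<lambda>j. {xs. set xs \<subseteq> layer E v q \<and> length xs = j} \<times> {..<j} \<times> nball E v q \<times> nball E v q"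
  have fin: "finite (?B j)" for j
    using finite_parts[OF E(1)] by (intro finite_cartesian_product finite_lists_length_eq) auto
  have "(\<Sum>t\<in>?T \<inter> ?C. odds ^ (case t of (xs, i, y, z) \<Rightarrow> length xs + 1)) \<le>
      (\<Sum>t\<in>(\<Union>j\<le>card V. ?B j). odds ^ (case t of (xs, i, y, z) \<Rightarrow> length xs + 1))"
    using fin odds_nonneg by (intro sum_mono2) auto
  also have "\<dots> = (\<Sum>j\<le>card V. \<Sum>t\<in>?B j. odds ^ (case t of (xs, i, y, z) \<Rightarrow> length xs + 1))"
    by (intro sum.UNION_disjoint) (use fin in auto)
  also have "\<dots> = (\<Sum>j\<le>card V. \<Sum>t\<in>?B j. odds ^ (j + 1))"
    by (intro sum.cong) auto
  also have "\<dots> = (\<Sum>j\<le>card V. (real (card (layer E v q)) ^ j * real j *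
      (real (card (nball E v q)))\<^sup>2) * odds ^ (j + 1))"
    using finite_parts[OF E(1)]
    by (simp add: card_cartesian_product card_lists_length_eq power2_eq_square mult_ac)
  also have "\<dots> \<le> (\<Sum>j\<le>card V. (R ^ j * real j * Q\<^sup>2) * odds ^ (j + 1))"
    using E(2) RQ unfolding ok_def
    by (intro sum_mono mult_right_mono mult_mono power_mono zero_le_power odds_nonneg) auto
  also have "\<dots> = Q\<^sup>2 * odds * (\<Sum>j\<le>card V. real j * (R * odds) ^ j)"
    by (simp only: sum_distrib_left power_mult_distrib power_add power_one_right mult_ac)
  also have "\<dots> \<le> Q\<^sup>2 * odds * (R * odds / (1 - R * odds)\<^sup>2)"
    by (intro mult_left_mono sum_arith_geometric_le R_odds_nonneg small mult_nonneg_nonneg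
        zero_le_power2 odds_nonneg)
  finally show "(\<Sum>t\<in>?T \<inter> ?C. odds ^ (case t of (xs, i, y, z) \<Rightarrow> length xs + 1)) \<le>
    Q\<^sup>2 * odds * (R * odds / (1 - R * odds)\<^sup>2)" .
qed (use p finV odds_nonneg RQ in \<open>auto simp: finite_pairs\<close>)

lemma expect_cycles:
  assumes small: "R * odds < 1"
  shows "expect p (pairs V) (\<lambda>E. of_bool (ok E) * real (card {c. is_cycle E (layer E v q) c})) \<le>
    (R * odds) ^ 3 / (1 - R * odds)"
proof (rule expect_count_le[where T = "{xs. set xs \<subseteq> V \<and> length xs \<le> card V}"
      and X = "\<lambda>xs. insert {last xs, hd xs} (path_edges xs)" and k = length
      and Cand = "\<lambda>E. {xs. set xs \<subseteq> layer E v q \<and> 3 \<le> length xs}"])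
  show "finite {xs. set xs \<subseteq> V \<and> length xs \<le> card V}" by (rule finite_lists_length_le[OF finV])
next
  fix E xs assume E: "E \<subseteq> pairs V" "ok E" and "xs \<in> {c. is_cycle E (layer E v q) c}"
  then have a: "xs \<noteq> []" "distinct xs" "set xs \<subseteq> layer E v q" "path_edges xs \<subseteq> E" "3 \<le> length xs"
    "{last xs, hd xs} \<in> E"
    by (auto simp: is_cycle_def is_path_def)
  let ?X = "insert {last xs, hd xs} (path_edges xs)"
  have "e \<notin> tree E v" if e: "e \<in> ?X" for e
  proof -
    have "e \<in> pairs V" using a e E by auto
    moreover have "e \<subseteq> set xs" using e a(1) path_edges_subset by auto
    ultimately obtain u w where "e = {u, w}" "u \<in> set xs" "w \<in> set xs"
      unfolding pairs_def card_2_iff by auto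
    then show ?thesis using tree_not_in_layer[of u E v q w] a(3) by auto
  qed
  then have X: "?X \<subseteq> E" "?X \<inter> tree E v = {}" using a by auto
  have "card ?X = length xs"
    using closing_edge_not_in_path[OF a(2,5)] a(5) by (simp add: card_path_edges[OF a(2)])
  moreover have "set xs \<subseteq> V" using a(3) finite_parts[OF E(1)] by blast
  moreover from this have "length xs \<le> card V" using card_mono[OF finV] distinct_card[OF a(2)] by metis
  ultimately show "xs \<in> {xs. set xs \<subseteq> V \<and> length xs \<le> card V} \<and> ?X \<subseteq> E \<and> card ?X = length xs \<and>
     ok (E - ?X) \<and> xs \<in> {xs. set xs \<subseteq> layer (E - ?X) v q \<and> 3 \<le> length xs}"
    using X(1) E(2) a(3,5) unfolding remove_edges[OF X] by blast
next
  fix E assume E: "E \<subseteq> pairs V" "ok E"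
  let ?T = "{xs. set xs \<subseteq> V \<and> length xs \<le> card V}"
  let ?C = "{xs. set xs \<subseteq> layer E v q \<and> 3 \<le> length xs}"
  let ?B = "\<lambda>j. {xs. set xs \<subseteq> layer E v q \<and> length xs = j}"
  have fin: "finite (?B j)" for j
    using finite_parts[OF E(1)] by (intro finite_lists_length_eq) auto
  have "(\<Sum>t\<in>?T \<inter> ?C. odds ^ length t) \<le> (\<Sum>t\<in>(\<Union>j\<in>{3..card V}. ?B j). odds ^ length t)"
    using fin odds_nonneg by (intro sum_mono2) auto
  also have "\<dots> = (\<Sum>j\<in>{3..card V}. \<Sum>t\<in>?B j. odds ^ length t)"
    by (intro sum.UNION_disjoint) (use fin in auto)
  also have "\<dots> = (\<Sum>j\<in>{3..card V}. \<Sum>t\<in>?B j. odds ^ j)"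
    by (intro sum.cong) auto
  also have "\<dots> = (\<Sum>j\<in>{3..card V}. real (card (layer E v q)) ^ j * odds ^ j)"
    using finite_parts[OF E(1)] by (simp add: card_lists_length_eq)
  also have "\<dots> \<le> (\<Sum>j\<in>{3..card V}. R ^ j * odds ^ j)"
    using E(2) odds_nonneg unfolding ok_def by (intro sum_mono mult_right_mono power_mono) auto
  also have "\<dots> = (\<Sum>j\<in>{3..card V}. (R * odds) ^ j)" by (simp only: power_mult_distrib)
  also have "\<dots> \<le> (R * odds) ^ 3 / (1 - R * odds)"
    by (intro sum_power_from_3_le R_odds_nonneg small)
  finally show "(\<Sum>t\<in>?T \<inter> ?C. odds ^ length t) \<le> (R * odds) ^ 3 / (1 - R * odds)" .
qed (use p finV odds_nonneg RQ small in \<open>auto simp: finite_pairs\<close>)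

text \<open>
  A ball of the right size is bad if its outermost layer contains a cycle or if the bound in
  \<open>min_degree_3_card_le\<close> reaches the threshold \<open>max 1 s\<close>. If it is not bad, then a
  subset of minimum degree at least 3 is empty or has fewer than \<open>s\<close> vertices.
\<close>

definition bad :: "real \<Rightarrow> 'a set set \<Rightarrow> bool" where
  "bad s E \<longleftrightarrow> ok E \<and> ((\<exists>c. is_cycle E (layer E v q) c) \<or>
     max 1 s \<le> real (card (chords E v q) + 3 * card (arms E v q)))"

lemma prob_bad_le:
  assumes small: "R * odds < 1"
  shows "prob p (pairs V) (bad s) \<le> (R * odds) ^ 3 / (1 - R * odds) +
    Q\<^sup>2 * odds * (1 + 3 * (R * odds / (1 - R * odds)\<^sup>2)) / max 1 s"
proof -
  let ?U = "pairs V"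
  let ?c = "\<lambda>E. of_bool (ok E) * real (card {c. is_cycle E (layer E v q) c})"
  let ?f = "\<lambda>E. of_bool (ok E) * real (card (chords E v q))"
  let ?g = "\<lambda>E. of_bool (ok E) * real (card (arms E v q))"
  have le1: "p \<le> 1" using p by simp
  have "prob p ?U (bad s) \<le> prob p ?U (\<lambda>E. (ok E \<and> (\<exists>c. is_cycle E (layer E v q) c)) \<or>
      (ok E \<and> max 1 s \<le> real (card (chords E v q) + 3 * card (arms E v q))))"
    by (intro prob_mono p(1) le1) (auto simp: bad_def)
  also have "\<dots> \<le> prob p ?U (\<lambda>E. ok E \<and> (\<exists>c. is_cycle E (layer E v q) c)) +
      prob p ?U (\<lambda>E. ok E \<and> max 1 s \<le> real (card (chords E v q) + 3 * card (arms E v q)))"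
    by (intro prob_disj_le p(1) le1)
  also have "prob p ?U (\<lambda>E. ok E \<and> (\<exists>c. is_cycle E (layer E v q) c)) \<le> expect p ?U ?c / 1"
  proof (intro prob_le_expect p(1) le1)
    fix E assume E: "E \<subseteq> ?U" and c: "ok E \<and> (\<exists>c. is_cycle E (layer E v q) c)"
    have "finite {c. is_cycle E (layer E v q) c}"
      using finite_subset[OF _ finite_is_path[OF finite_parts(4)[OF E, of q], of E]]
      by (auto simp: is_cycle_def)
    then have "card {c. is_cycle E (layer E v q) c} \<noteq> 0" using c by auto
    then show "1 \<le> ?c E" using c by simp
  qed auto
  also have "prob p ?U (\<lambda>E. ok E \<and> max 1 s \<le> real (card (chords E v q) + 3 * card (arms E v q)))
      \<le> expect p ?U (\<lambda>E. ?f E + 3 * ?g E) / max 1 s"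
    by (intro prob_le_expect p(1) le1) auto
  also have "expect p ?U (\<lambda>E. ?f E + 3 * ?g E) = expect p ?U ?f + 3 * expect p ?U ?g"
    by (simp only: expect_add expect_cmult)
  also have "\<dots> \<le> Q\<^sup>2 * odds + 3 * (Q\<^sup>2 * odds * (R * odds / (1 - R * odds)\<^sup>2))"
    using expect_chords expect_arms[OF small] by linarith
  also have "\<dots> = Q\<^sup>2 * odds * (1 + 3 * (R * odds / (1 - R * odds)\<^sup>2))"
    by (simp add: algebra_simps)
  finally show ?thesis using expect_cycles[OF small]
    by (simp add: divide_right_mono)
qed

lemma colorable_ball:
  assumes E: "E \<subseteq> pairs V" "ok E" "\<not> bad s E"
    and sparse: "\<And>H. H \<subseteq> V \<Longrightarrow> 4 \<le> card H \<Longrightarrow> real (card H) < s \<Longrightarrow> 2 * card (E \<inter> pairs H) < 3 * card H"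
  shows "colorable_on E 3 (nball E v (Suc q))"
proof (rule colorable_on_if_degenerate[OF finite_parts(3)[OF E(1)] E(1)], rule ccontr)
  fix H assume H: "H \<subseteq> nball E v (Suc q)" "H \<noteq> {}" "\<not> (\<exists>x\<in>H. card {w \<in> H. {x, w} \<in> E} < 3)"
  then have deg: "3 \<le> card {w \<in> H. {x, w} \<in> E}" if "x \<in> H" for x using that by force
  have HV: "H \<subseteq> V" using H(1) finite_parts(1)[OF E(1)] by blast
  then have finH: "finite H" using finV finite_subset by blast
  have "card H \<le> card (chords E v q) + 3 * card (arms E v q)"
    by (rule min_degree_3_card_le[OF finV E(1) vV H(1) deg]) (use E in \<open>auto simp: bad_def\<close>)
  moreover have "real (card (chords E v q) + 3 * card (arms E v q)) < max 1 s"
    using E by (auto simp: bad_def)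
  ultimately have "real (card H) < max 1 s" by linarith
  moreover have ge4: "4 \<le> card H"
    using H(2) min_degree_3_card_ge_4[OF finH E(1) _ deg] by blast
  ultimately have "real (card H) < s" by (simp add: max_def split: if_splits)
  then show False using sparse[OF HV ge4] min_degree_3_dense[OF finH E(1) deg] by linarith
qed

end

section \<open>Degrees, independent sets and dense sets in the random graph\<close>

definition nbrs :: "'a set set \<Rightarrow> 'a \<Rightarrow> 'a set" where
  "nbrs E x = {y. {x, y} \<in> E}"

lemma card_layer_le:
  assumes "finite V" "E \<subseteq> pairs V" "v \<in> V" and D: "\<And>x. x \<in> V \<Longrightarrow> real (card (nbrs E x)) \<le> D"
  shows "real (card (layer E v i)) \<le> D ^ Suc i"
proof -
  have fin: "finite (nbrs E x)" for x
    by (rule finite_subset[OF _ assms(1)]) (use assms(2) in \<open>auto simp: nbrs_def pairs_def\<close>)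
  show ?thesis
  proof (induction i)
    case 0
    have "layer E v 0 \<subseteq> nbrs E v" by (auto simp: layer_def nbrs_def)
    then have "card (layer E v 0) \<le> card (nbrs E v)" by (intro card_mono fin)
    then show ?case using D[OF assms(3)] by simp
  next
    case (Suc i)
    have lV: "layer E v i \<subseteq> V" unfolding layer_def using nball_subset[OF assms(2,3)] by blast
    then have fl: "finite (layer E v i)" using assms(1) finite_subset by blast
    have "layer E v (Suc i) \<subseteq> (\<Union>x\<in>layer E v i. nbrs E x)"
      by (auto simp: layer_def nbrs_def)
    then have "card (layer E v (Suc i)) \<le> card (\<Union>x\<in>layer E v i. nbrs E x)"
      by (intro card_mono finite_UN_I fin fl)
    also have "\<dots> \<le> (\<Sum>x\<in>layer E v i. card (nbrs E x))" by (rule card_UN_le[OF fl])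
    finally have "real (card (layer E v (Suc i))) \<le> (\<Sum>x\<in>layer E v i. real (card (nbrs E x)))"
      by (simp flip: of_nat_sum)
    also have "\<dots> \<le> (\<Sum>x\<in>layer E v i. D)" using lV by (intro sum_mono D) auto
    also have "\<dots> = real (card (layer E v i)) * D" by simp
    also have "\<dots> \<le> D ^ Suc i * D"
      using D[OF assms(3)] by (intro mult_right_mono Suc) simp
    finally show ?case by (simp add: mult_ac)
  qed
qed

lemma card_nball_le:
  assumes "finite V" "E \<subseteq> pairs V" "v \<in> V" and D: "\<And>x. x \<in> V \<Longrightarrow> real (card (nbrs E x)) \<le> D"
  shows "real (card (nball E v i)) \<le> (\<Sum>j\<le>i. D ^ j)"
proof (induction i)
  case (Suc i)
  have "nball E v (Suc i) = nball E v i \<union> layer E v i" by (auto simp: layer_def)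
  then have "card (nball E v (Suc i)) \<le> card (nball E v i) + card (layer E v i)"
    by (metis card_Un_le)
  moreover have "real (card (layer E v i)) \<le> D ^ Suc i" by (rule card_layer_le[OF assms(1-3) D])
  ultimately show ?case using Suc by (simp only: sum.atMost_Suc)
qed simp

text \<open>
  A Chernoff bound with base 2 for the degree of each vertex, and a union bound over all vertices.
\<close>

lemma prob_degree:
  assumes "finite V" "0 \<le> p" "p \<le> 1"
  shows "prob p (pairs V) (\<lambda>E. \<exists>x\<in>V. D < real (card (nbrs E x))) \<le>
    real (card V) * (exp (p * real (card V)) / 2 powr D)"
proof -
  have "prob p (pairs V) (\<lambda>E. D < real (card (nbrs E x))) \<le> exp (p * real (card V)) / 2 powr D"
    if x: "x \<in> V" for x
  proof -
    let ?A = "(\<lambda>y. {x, y}) ` (V - {x})"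
    have A: "?A \<subseteq> pairs V" using x by (auto simp: insert_in_pairs_iff)
    have cA: "card ?A \<le> card V"
      using card_image_le[of "V - {x}" "\<lambda>y. {x, y}"] card_mono[of V "V - {x}"] assms(1) by fastforce
    have nb: "card (nbrs E x) \<le> card (E \<inter> ?A)" if E: "E \<subseteq> pairs V" for E
    proof (rule card_inj_on_le)
      show "inj_on (\<lambda>y. {x, y}) (nbrs E x)" by (auto simp: inj_on_def doubleton_eq_iff)
      show "(\<lambda>y. {x, y}) ` nbrs E x \<subseteq> E \<inter> ?A"
      proof
        fix e assume "e \<in> (\<lambda>y. {x, y}) ` nbrs E x"
        then obtain y where y: "e = {x, y}" "{x, y} \<in> E" by (auto simp: nbrs_def)
        then have "y \<in> V - {x}" using E insert_in_pairs_iff[of x y V] by auto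
        then show "e \<in> E \<inter> ?A" using y by simp
      qed
      show "finite (E \<inter> ?A)" using assms(1) by simp
    qed
    have "prob p (pairs V) (\<lambda>E. D < real (card (nbrs E x))) \<le>
        expect p (pairs V) (\<lambda>E. 2 ^ card (E \<inter> ?A)) / 2 powr D"
    proof (intro prob_le_expect assms(2,3))
      fix E assume E: "E \<subseteq> pairs V" "D < real (card (nbrs E x))"
      then have "2 powr D \<le> 2 powr real (card (E \<inter> ?A))"
        using nb[OF E(1)] by (intro powr_mono) auto
      then show "2 powr D \<le> 2 ^ card (E \<inter> ?A)" by (simp add: powr_realpow)
    qed auto
    also have "expect p (pairs V) (\<lambda>E. 2 ^ card (E \<inter> ?A)) = (1 + p) ^ card ?A"
      using expect_power_card_Int[OF finite_pairs[OF assms(1)] A, of p 2] by simp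
    also have "\<dots> \<le> (1 + p) ^ card V" using cA assms(2) by (intro power_increasing) auto
    also have "\<dots> \<le> exp p ^ card V" using assms(2) by (intro power_mono exp_ge_add_one_self) auto
    also have "\<dots> = exp (p * real (card V))" by (simp add: exp_of_nat2_mult)
    finally show ?thesis by (simp add: divide_right_mono)
  qed
  then have "(\<Sum>x\<in>V. prob p (pairs V) (\<lambda>E. D < real (card (nbrs E x)))) \<le>
      (\<Sum>x\<in>V. exp (p * real (card V)) / 2 powr D)" by (intro sum_mono)
  then show ?thesis
    using prob_Bex_le[OF assms(2,3,1), of "pairs V" "\<lambda>x E. D < real (card (nbrs E x))"] by simp
qed

lemma binomial_le_power:
  assumes "0 < k"
  shows "real (n choose k) \<le> (exp 1 * real n / real k) ^ k"
proof -
  have "real k ^ k / fact k \<le> exp (real k)"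
  proof -
    have "(\<Sum>i\<in>{k}. real k ^ i /\<^sub>R fact i) \<le> (\<Sum>i. real k ^ i /\<^sub>R fact i)"
      by (rule sum_le_suminf[OF summable_exp_generic]) auto
    then show ?thesis by (simp add: exp_def divide_inverse mult.commute)
  qed
  then have 1: "real k ^ k \<le> exp (real k) * fact k" by (simp add: field_simps)
  have "real (n choose k) * fact k \<le> real n ^ k"
    using binomial_fact_pow[of n k] by (metis of_nat_le_iff of_nat_mult of_nat_fact of_nat_power)
  then have "real (n choose k) * real k ^ k * fact k \<le> exp (real k) * fact k * real n ^ k"
    using mult_mono[OF _ 1, of "real (n choose k) * fact k" "real n ^ k"] by (simp add: mult_ac)
  then have "real (n choose k) * real k ^ k \<le> exp (real k) * real n ^ k"
    by (simp add: mult_ac)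
  moreover have "exp (real k) = exp 1 ^ k" using exp_of_nat_mult[of k "1::real"] by simp
  ultimately show ?thesis using assms by (simp add: power_divide power_mult_distrib field_simps)
qed

lemma prob_subset_le:
  assumes "finite V" "0 \<le> p" "p \<le> 1" "0 < j" "0 \<le> b"
    and "\<And>S. S \<subseteq> V \<Longrightarrow> card S = j \<Longrightarrow> prob p U (P S) \<le> b"
  shows "prob p U (\<lambda>E. \<exists>S\<subseteq>V. card S = j \<and> P S E) \<le> (exp 1 * real (card V) / real j) ^ j * b"
proof -
  have "prob p U (\<lambda>E. \<exists>S\<subseteq>V. card S = j \<and> P S E) = prob p U (\<lambda>E. \<exists>S\<in>{S. S \<subseteq> V \<and> card S = j}. P S E)"
    by (intro arg_cong[of _ _ "prob p U"]) auto
  also have "\<dots> \<le> (\<Sum>S\<in>{S. S \<subseteq> V \<and> card S = j}. prob p U (P S))"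
    using assms(1) by (intro prob_Bex_le assms(2,3)) simp
  also have "\<dots> \<le> (\<Sum>S\<in>{S. S \<subseteq> V \<and> card S = j}. b)"
    by (intro sum_mono assms(6)) auto
  also have "\<dots> = real (card V choose j) * b" using n_subsets[OF assms(1)] by simp
  also have "\<dots> \<le> (exp 1 * real (card V) / real j) ^ j * b"
    by (intro mult_right_mono binomial_le_power assms)
  finally show ?thesis .
qed

lemma prob_independent:
  assumes "finite V" "0 \<le> p" "p \<le> 1" "0 < k"
  shows "prob p (pairs V) (\<lambda>E. \<exists>S\<subseteq>V. card S = k \<and> E \<inter> pairs S = {}) \<le>
    (exp 1 * real (card V) / real k * exp (- (p * (real k - 1) / 2))) ^ k"
proof -
  have "prob p (pairs V) (\<lambda>E. E \<inter> pairs S = {}) \<le> exp (- (p * (real k - 1) / 2)) ^ k"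
    if S: "S \<subseteq> V" "card S = k" for S
  proof -
    have "finite S" using S assms(1) finite_subset by blast
    then have c: "real (card (pairs S)) = real k * (real k - 1) / 2"
      using card_pairs[of S] S(2) assms(4)
      by (simp add: choose_two real_of_nat_div of_nat_diff)
    have "(1 - p) ^ card (pairs S) \<le> exp (- p) ^ card (pairs S)"
      using assms exp_ge_add_one_self[of "- p"] by (intro power_mono) auto
    also have "\<dots> = exp (- p * real (card (pairs S)))" by (rule exp_of_nat2_mult[symmetric])
    also have "\<dots> = exp (real k * (- (p * (real k - 1) / 2)))"
      unfolding c by (simp add: mult_ac)
    also have "\<dots> = exp (- (p * (real k - 1) / 2)) ^ k" by (rule exp_of_nat_mult)
    finally have "(1 - p) ^ card (pairs S) \<le> exp (- (p * (real k - 1) / 2)) ^ k" .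
    then show ?thesis
      using prob_avoid[OF finite_pairs[OF assms(1)] pairs_mono[OF S(1)]] by simp
  qed
  from prob_subset_le[OF assms _ this] show ?thesis by (simp only: power_mult_distrib) simp
qed

text \<open>
  Small sets are sparse: with \<open>s = 1 / 36 / (n\<^sup>2 * p ^ 3)\<close>, it is unlikely that some set of at least 4
  and fewer than \<open>s\<close> vertices spans as many edges as minimum degree 3 requires. For a set of \<open>j\<close>
  vertices the Chernoff bound is applied with the base \<open>z = 3 / (p * j)\<close>; the choice of \<open>s\<close> makes the
  contribution of all sets of \<open>j\<close> vertices at most \<open>(1 / 2) ^ j\<close>.
\<close>

lemma prob_dense:
  assumes V: "finite V" "card V = n" and p: "0 < p" "p \<le> 1" and np: "1 \<le> real n * p"
  shows "prob p (pairs V) (\<lambda>E. \<exists>S\<subseteq>V. 4 \<le> card S \<and> real (card S) < 1 / 36 / ((real n)\<^sup>2 * p ^ 3) \<and>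
    3 * card S \<le> 2 * card (E \<inter> pairs S)) \<le> 1 / 8"
proof -
  define s where "s = 1 / 36 / ((real n)\<^sup>2 * p ^ 3)"
  have npos: "0 < real n" using np p by (cases n) auto
  let ?J = "{j\<in>{4..n}. real j < s}"
  let ?P = "\<lambda>j E. \<exists>S\<subseteq>V. card S = j \<and> 3 * card S \<le> 2 * card (E \<inter> pairs S)"
  have one: "prob p (pairs V) (?P j) \<le> (1 / 2) ^ j" if j: "j \<in> ?J" for j
  proof -
    have jpos: "0 < real j" using j by auto
    have js: "real j * ((real n)\<^sup>2 * p ^ 3) < 1 / 36"
      using j npos p by (simp add: s_def pos_less_divide_eq)
    \<comment> \<open>The base that minimizes \<open>exp (z * p * j\<^sup>2 / 2) / z powr (3 * j / 2)\<close>.\<close>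
    define z where "z = 3 / (p * real j)"
    have z0: "0 < z" using p jpos by (simp add: z_def)
    have z1: "1 \<le> z"
    proof -
      have "p * real j * 1 \<le> p * real j * (real n * p)\<^sup>2"
        using one_le_power[OF np, of 2] p jpos by (intro mult_left_mono) auto
      also have "\<dots> = real j * ((real n)\<^sup>2 * p ^ 3)" by (simp add: power2_eq_square power3_eq_cube)
      finally have "p * real j \<le> 3" using js by simp
      then show ?thesis using p jpos by (simp add: z_def)
    qed
    have "prob p (pairs V) (\<lambda>E. 3 * card S \<le> 2 * card (E \<inter> pairs S)) \<le> (exp (3 / 2) / sqrt z ^ 3) ^ j"
      if S: "S \<subseteq> V" "card S = j" for S
    proof -
      have fS: "finite S" using S V(1) finite_subset by blast
      have "prob p (pairs V) (\<lambda>E. 3 * card S \<le> 2 * card (E \<inter> pairs S)) \<le>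
          expect p (pairs V) (\<lambda>E. z ^ card (E \<inter> pairs S)) / sqrt z ^ (3 * j)"
      proof (intro prob_le_expect)
        fix E assume "3 * card S \<le> 2 * card (E \<inter> pairs S)"
        then have "sqrt z ^ (3 * j) \<le> sqrt z ^ (2 * card (E \<inter> pairs S))"
          using z1 S(2) by (intro power_increasing) auto
        also have "\<dots> = z ^ card (E \<inter> pairs S)" using z0 by (simp add: power_mult)
        finally show "sqrt z ^ (3 * j) \<le> z ^ card (E \<inter> pairs S)" .
      qed (use p z0 in auto)
      also have "expect p (pairs V) (\<lambda>E. z ^ card (E \<inter> pairs S)) = (1 + (z - 1) * p) ^ card (pairs S)"
        by (rule expect_power_card_Int[OF finite_pairs[OF V(1)] pairs_mono[OF S(1)]])
      also have "\<dots> \<le> exp (z * p) ^ card (pairs S)"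
      proof (intro power_mono)
        have "1 + (z - 1) * p \<le> 1 + z * p" using p by (simp add: algebra_simps)
        then show "1 + (z - 1) * p \<le> exp (z * p)" using exp_ge_add_one_self[of "z * p"] by linarith
        have "0 \<le> (z - 1) * p" using z1 p by simp
        then show "0 \<le> 1 + (z - 1) * p" by linarith
      qed
      also have "\<dots> = exp (z * p * real (card (pairs S)))" by (simp add: exp_of_nat2_mult)
      also have "\<dots> \<le> exp (z * p * ((real j)\<^sup>2 / 2))"
        using of_card_pairs_le[OF fS] S(2) z0 p by (simp add: mult_left_mono)
      also have "z * p * ((real j)\<^sup>2 / 2) = real j * (3 / 2)"
        using p jpos by (simp add: z_def power2_eq_square field_simps)
      also have "exp (real j * (3 / 2)) = exp (3 / 2) ^ j" by (rule exp_of_nat_mult)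
      finally show ?thesis using z0
        by (simp add: power_divide power_mult divide_right_mono)
    qed
    then have "prob p (pairs V) (?P j) \<le>
        (exp 1 * real (card V) / real j) ^ j * (exp (3 / 2) / sqrt z ^ 3) ^ j"
      using p jpos z0 V(1) by (intro prob_subset_le) auto
    also have "\<dots> = (exp 1 * real n / real j * (exp (3 / 2) / sqrt z ^ 3)) ^ j"
      by (simp only: V(2) power_mult_distrib)
    also have "\<dots> \<le> (1 / 2) ^ j"
    proof (intro power_mono)
      let ?b = "exp 1 * real n / real j * (exp (3 / 2) / sqrt z ^ 3)"
      show "0 \<le> ?b" using z0 by simp
      have e3: "(exp (3 / 2 :: real))\<^sup>2 = exp 1 ^ 3"
        using exp_of_nat_mult[of 2 "3 / 2 :: real"] exp_of_nat_mult[of 3 "1 :: real"] by simp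
      have sz: "(sqrt z ^ 3)\<^sup>2 = z ^ 3"
        using z0 power_mult[of "sqrt z" 3 2] power_mult[of "sqrt z" 2 3] by simp
      have "?b\<^sup>2 = (exp 1 ^ 2 * (real n)\<^sup>2 / (real j)\<^sup>2) * (exp 1 ^ 3 / z ^ 3)"
        by (simp only: power_mult_distrib power_divide e3 sz)
      also have "\<dots> = exp 1 ^ 5 / 27 * (real j * ((real n)\<^sup>2 * p ^ 3))"
        using p jpos by (simp add: z_def field_simps power2_eq_square power3_eq_cube numeral_eq_Suc)
      also have "\<dots> \<le> 3 ^ 5 / 27 * (1 / 36)"
        using exp_le js p by (intro mult_mono divide_right_mono power_mono) auto
      also have "\<dots> \<le> (1 / 2)\<^sup>2" by (simp add: field_simps)
      finally show "?b \<le> 1 / 2" by (rule power2_le_imp_le) simp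
    qed
    finally show ?thesis .
  qed
  have "prob p (pairs V) (\<lambda>E. \<exists>S\<subseteq>V. 4 \<le> card S \<and> real (card S) < s \<and>
      3 * card S \<le> 2 * card (E \<inter> pairs S)) \<le> prob p (pairs V) (\<lambda>E. \<exists>j\<in>?J. ?P j E)"
  proof (intro prob_mono)
    fix E assume "\<exists>S\<subseteq>V. 4 \<le> card S \<and> real (card S) < s \<and> 3 * card S \<le> 2 * card (E \<inter> pairs S)"
    then obtain S where S: "S \<subseteq> V" "4 \<le> card S" "real (card S) < s"
      "3 * card S \<le> 2 * card (E \<inter> pairs S)" by blast
    then have "card S \<in> ?J" using card_mono[OF V(1) S(1)] V(2) by auto
    then show "\<exists>j\<in>?J. ?P j E" using S by blast
  qed (use p in auto)
  also have "\<dots> \<le> (\<Sum>j\<in>?J. prob p (pairs V) (?P j))"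
    using p by (intro prob_Bex_le) auto
  also have "\<dots> \<le> (\<Sum>j\<in>?J. (1 / 2) ^ j)" by (intro sum_mono one)
  also have "\<dots> \<le> (\<Sum>j\<in>(\<lambda>i. i + 4) ` {..<n}. (1 / 2) ^ j)"
  proof (intro sum_mono2)
    show "?J \<subseteq> (\<lambda>i. i + 4) ` {..<n}"
    proof
      fix j assume "j \<in> ?J"
      then have "j = (j - 4) + 4" "j - 4 \<in> {..<n}" by auto
      then show "j \<in> (\<lambda>i. i + 4) ` {..<n}" by (rule image_eqI)
    qed
  qed auto
  also have "\<dots> = (1 / 2) ^ 4 * (\<Sum>i<n. (1 / 2) ^ i)"
    by (subst sum.reindex) (auto simp: power_add sum_distrib_right mult.commute)
  also have "\<dots> \<le> (1 / 2) ^ 4 * (1 / (1 - 1 / 2))"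
    by (intro mult_left_mono sum_geometric_le) auto
  also have "\<dots> = 1 / 8" by (simp add: power_divide)
  finally show ?thesis by (simp only: s_def)
qed

text \<open>
  The four failure probabilities (a large degree, an independent set of size \<open>k\<close>, a small dense
  set, and more than \<open>n / 10\<close> bad vertices) are at most 1/100, 1/100, 1/8 and 1/2. The last one
  is Markov's inequality: each vertex is bad with probability at most 1/20. The set \<open>W\<close> consists
  of the bad vertices.
\<close>

lemma locally_3_colorable_random_graph:
  fixes V :: "'a set" and p d D :: real and q k :: nat
  defines "n \<equiv> real (card V)"
  defines "D \<equiv> 2 * d" and "R \<equiv> D ^ Suc q" and "Q \<equiv> \<Sum>j\<le>q. D ^ j" and "odds \<equiv> p / (1 - p)"
  assumes V: "finite V" and p: "0 < p" "p < 1" and d: "d = n * p" "1 \<le> d" and k: "0 < k"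
    and degree: "n * (exp d / 2 powr D) \<le> 1 / 100"
    and indep: "(exp 1 * n / real k * exp (- (p * (real k - 1) / 2))) ^ k \<le> 1 / 100"
    and small: "R * odds < 1"
    and bad: "(R * odds) ^ 3 / (1 - R * odds) +
      Q\<^sup>2 * odds * (1 + 3 * (R * odds / (1 - R * odds)\<^sup>2)) / max 1 (1 / 36 / (n\<^sup>2 * p ^ 3)) \<le> 1 / 20"
  obtains E W where "E \<subseteq> pairs V" "W \<subseteq> V" "real (card W) \<le> n / 10"
    "\<And>S. S \<subseteq> V \<Longrightarrow> card S = k \<Longrightarrow> E \<inter> pairs S \<noteq> {}"
    "\<And>v. v \<in> V - W \<Longrightarrow> colorable_on E 3 (nball E v (Suc q))"
proof -
  define s where "s = 1 / 36 / (n\<^sup>2 * p ^ 3)"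
  define B where "B E = {v\<in>V. exposed_vertex.bad v q R Q s E}" for E
  let ?deg = "\<lambda>E. \<exists>x\<in>V. D < real (card (nbrs E x))"
  let ?ind = "\<lambda>E. \<exists>S\<subseteq>V. card S = k \<and> E \<inter> pairs S = {}"
  let ?den = "\<lambda>E. \<exists>S\<subseteq>V. 4 \<le> card S \<and> real (card S) < s \<and> 3 * card S \<le> 2 * card (E \<inter> pairs S)"
  let ?bad = "\<lambda>E. n / 10 < real (card (B E))"
  let ?U = "pairs V"
  have p': "0 \<le> p" "p \<le> 1" using p by auto
  have n: "0 < n" using d p by (cases "n = 0") (auto simp: n_def)
  have D0: "0 \<le> D" using d by (simp add: D_def)
  have RQ: "0 \<le> R" "0 \<le> Q" unfolding R_def Q_def using D0 by (auto intro: sum_nonneg)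
  have ev: "exposed_vertex V v p R Q" if "v \<in> V" for v
    by (unfold_locales) (use that V p RQ in auto)
  have 1: "prob p ?U ?deg \<le> 1 / 100"
    using prob_degree[OF V p', of D, folded n_def] degree
    unfolding d(1) mult.commute[of p n] by linarith
  have 2: "prob p ?U ?ind \<le> 1 / 100"
    using prob_independent[OF V p' k] indep by (simp add: n_def)
  have 3: "prob p ?U ?den \<le> 1 / 8"
    using prob_dense[OF V refl p(1) p'(2), folded n_def] d by (simp add: n_def s_def)
  have 4: "prob p ?U ?bad \<le> 1 / 2"
  proof -
    have "prob p ?U (exposed_vertex.bad v q R Q s) \<le> 1 / 20" if "v \<in> V" for v
      using exposed_vertex.prob_bad_le[OF ev[OF that], of q s] small bad
      unfolding s_def odds_def by linarith
    then have "(\<Sum>v\<in>V. prob p ?U (exposed_vertex.bad v q R Q s)) \<le> (\<Sum>v\<in>V. 1 / 20)"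
      by (intro sum_mono)
    moreover have "(\<Sum>v\<in>V. prob p ?U (exposed_vertex.bad v q R Q s)) = expect p ?U (\<lambda>E. real (card (B E)))"
      unfolding prob_def expect_sum[symmetric] B_def using V
      by (intro arg_cong[of _ _ "expect p ?U"] ext) (simp add: sum.If_cases of_bool_def Int_def)
    ultimately have e: "expect p ?U (\<lambda>E. real (card (B E))) \<le> n / 20" by (simp add: n_def)
    have "prob p ?U ?bad \<le> expect p ?U (\<lambda>E. real (card (B E))) / (n / 10)"
      using n by (intro prob_le_expect p') auto
    also have "\<dots> \<le> (n / 20) / (n / 10)" using e n by (intro divide_right_mono) auto
    finally have "prob p ?U ?bad \<le> (n / 20) / (n / 10)" .
    then show ?thesis using n by simp
  qed
  have less: "prob p ?U (\<lambda>E. ?deg E \<or> ?ind E \<or> ?den E \<or> ?bad E) < 1"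
    using prob_disj_le[OF p', of ?U ?deg "\<lambda>E. ?ind E \<or> ?den E \<or> ?bad E"]
      prob_disj_le[OF p', of ?U ?ind "\<lambda>E. ?den E \<or> ?bad E"]
      prob_disj_le[OF p', of ?U ?den ?bad] 1 2 3 4 by linarith
  obtain E where E: "E \<subseteq> ?U" "\<not> (?deg E \<or> ?ind E \<or> ?den E \<or> ?bad E)"
    by (rule ex_if_prob_less_1[OF p' finite_pairs[OF V] less])
  show ?thesis
  proof (rule that[OF E(1)])
    show "B E \<subseteq> V" by (auto simp: B_def)
    show "real (card (B E)) \<le> n / 10" using E(2) by linarith
    show "E \<inter> pairs S \<noteq> {}" if "S \<subseteq> V" "card S = k" for S using E(2) that by blast
    fix v assume v: "v \<in> V - B E"
    then interpret exposed_vertex V v q p R Q using ev by simp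
    have deg: "real (card (nbrs E x)) \<le> D" if "x \<in> V" for x
      using E(2) that by (meson not_le)
    have "ok E"
      unfolding ok_def unfolding R_def Q_def
      by (intro conjI card_layer_le[OF V E(1) vV deg] card_nball_le[OF V E(1) vV deg])
    moreover have "\<not> bad s E" using v by (simp add: B_def)
    moreover have "2 * card (E \<inter> pairs H) < 3 * card H"
      if "H \<subseteq> V" "4 \<le> card H" "real (card H) < s" for H
    proof -
      have "\<not> 3 * card H \<le> 2 * card (E \<inter> pairs H)" using E(2) that by blast
      then show ?thesis by simp
    qed
    ultimately show "colorable_on E 3 (nball E v (Suc q))" by (intro colorable_ball[OF E(1)])
  qed
qed

section \<open>From edge sets to graphs\<close>

text \<open>
  The graph on \<open>{..<m}\<close> with the edges of \<open>E\<close> that avoid \<open>W\<close>. The vertices of \<open>W\<close> become isolated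
  instead of being removed, so that the number of vertices can be prescribed.
\<close>

definition graph_of :: "nat set set \<Rightarrow> nat set \<Rightarrow> nat \<Rightarrow> nat pair_pre_digraph" where
  "graph_of E W m = \<lparr> pverts = {..<m}, parcs = {(x, y). {x, y} \<in> E \<and> x \<notin> W \<and> y \<notin> W} \<rparr>"

lemma graph_of_simps [simp]:
  "pverts (graph_of E W m) = {..<m}"
  "parcs (graph_of E W m) = {(x, y). {x, y} \<in> E \<and> x \<notin> W \<and> y \<notin> W}"
  by (simp_all add: graph_of_def)

lemma pair_graph_graph_of:
  assumes "E \<subseteq> pairs {..<n}" "n \<le> m"
  shows "pair_graph (graph_of E W m)"
proof -
  have edge: "x < m" "y < m" "x \<noteq> y" if "{x, y} \<in> E" for x y
  proof -
    have "{x, y} \<in> pairs {..<n}" using assms(1) that by blast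
    then show "x < m" "y < m" "x \<noteq> y" using assms(2) by (auto simp: insert_in_pairs_iff)
  qed
  then have sub: "parcs (graph_of E W m) \<subseteq> {..<m} \<times> {..<m}" by auto
  show ?thesis
  proof
    show "finite (parcs (graph_of E W m))" by (rule finite_subset[OF sub]) simp
    show "symmetric (with_proj (graph_of E W m))"
      by (auto simp: symmetric_def sym_def insert_commute)
  qed (use edge in auto)
qed

lemma awalk_in_nball:
  assumes wf: "wf_digraph (with_proj (graph_of E W m))"
    and "x \<in> nball E v i" "pre_digraph.awalk (with_proj (graph_of E W m)) x p u"
  shows "u \<in> nball E v (i + length p)"
proof -
  interpret wf_digraph "with_proj (graph_of E W m)" by fact
  show ?thesis using assms(2,3)
  proof (induction p arbitrary: x i)
    case Nil
    then show ?case by (simp add: awalk_Nil_iff)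
  next
    case (Cons a p)
    obtain y where a: "a = (x, y)" "{x, y} \<in> E" "awalk y p u"
      using Cons.prems(2) by (cases a) (auto simp: awalk_Cons_iff)
    then have "y \<in> nball E v (Suc i)" using Cons.prems(1) by auto
    then show ?case using Cons.IH[OF _ a(3)] by fastforce
  qed
qed

lemma awalk_from_isolated:
  assumes wf: "wf_digraph (with_proj (graph_of E W m))"
    and "x \<in> W \<or> x \<notin> \<Union>E" "pre_digraph.awalk (with_proj (graph_of E W m)) x p u"
  shows "u = x"
proof -
  interpret wf_digraph "with_proj (graph_of E W m)" by fact
  show ?thesis using assms(2,3)
    by (cases p) (auto simp: awalk_Cons_iff awalk_Nil_iff)
qed

lemma chromatic_number_le:
  assumes "colorable_on E k (verts H)"
    "\<And>a. a \<in> arcs H \<Longrightarrow> tail H a \<in> verts H \<and> head H a \<in> verts H \<and> {tail H a, head H a} \<in> E"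
  shows "chromatic_number H \<le> k"
proof -
  obtain f where "\<forall>x\<in>verts H. f x < k" "\<forall>x\<in>verts H. \<forall>y\<in>verts H. {x, y} \<in> E \<longrightarrow> f x \<noteq> f y"
    using assms(1) unfolding colorable_on_def by blast
  then have "proper_coloring H k f" using assms(2) unfolding proper_coloring_def by blast
  then have "colorable H k" unfolding colorable_def by blast
  then show ?thesis unfolding chromatic_number_def by (rule Least_le)
qed

lemma local_chromatic_number_graph_of:
  assumes E: "E \<subseteq> pairs {..<n}" and m: "n \<le> m" "0 < m" and W: "W \<subseteq> {..<n}"
    and col: "\<And>v. v \<in> {..<n} - W \<Longrightarrow> colorable_on E 3 (nball E v r)"
  shows "local_chromatic_number r (with_proj (graph_of E W m)) \<le> 3"
proof -
  let ?G = "with_proj (graph_of E W m)"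
  interpret pair_graph "graph_of E W m" by (rule pair_graph_graph_of[OF E m(1)])
  have wf: "wf_digraph ?G" by (rule wf_digraph_axioms)
  have ball: "verts (graph_ball r v ?G) = {u\<in>{..<m}. \<exists>p. awalk v p u \<and> length p \<le> r}" for v
    by (simp add: graph_ball_def graph_dist_le_iff[OF wf])
  have edges: "tail (graph_ball r v ?G) a \<in> verts (graph_ball r v ?G) \<and>
      head (graph_ball r v ?G) a \<in> verts (graph_ball r v ?G) \<and>
      {tail (graph_ball r v ?G) a, head (graph_ball r v ?G) a} \<in> E"
    if "a \<in> arcs (graph_ball r v ?G)" for a v
    using that by (auto simp: graph_ball_def)
  have "chromatic_number (graph_ball r v ?G) \<le> 3" if v: "v \<in> {..<m}" for v
  proof (rule chromatic_number_le[OF _ edges])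
    show "colorable_on E 3 (verts (graph_ball r v ?G))"
    proof (cases "v \<in> W \<or> n \<le> v")
      case True
      have "\<Union>E \<subseteq> {..<n}" using E unfolding pairs_def by blast
      then have "v \<notin> \<Union>E" if "n \<le> v" using that by auto
      then have "verts (graph_ball r v ?G) \<subseteq> {v}"
        using awalk_from_isolated[OF wf] True unfolding ball by blast
      moreover have "{v} \<notin> E" using E by (auto simp: pairs_def)
      then have "colorable_on E 3 {v}" unfolding colorable_on_def by (intro exI[of _ "\<lambda>_. 0"]) auto
      ultimately show ?thesis using colorable_on_mono[OF _ order_refl] by blast
    next
      case False
      have "verts (graph_ball r v ?G) \<subseteq> nball E v r"
      proof
        fix u assume "u \<in> verts (graph_ball r v ?G)"
        then obtain p where p: "awalk v p u" "length p \<le> r" unfolding ball by blast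
        then have "u \<in> nball E v (length p)" using awalk_in_nball[OF wf _ p(1), of v 0] by simp
        then show "u \<in> nball E v r" using nball_mono[OF p(2), of E v] by blast
      qed
      moreover have "colorable_on E 3 (nball E v r)" using False by (intro col) auto
      ultimately show ?thesis using colorable_on_mono[OF _ order_refl] by blast
    qed
  qed
  then show ?thesis using m(2) unfolding local_chromatic_number_def
    by (subst Max_le_iff) auto
qed

lemma not_colorable_graph_of:
  assumes m: "n \<le> m" and W: "W \<subseteq> {..<n}" and k: "0 < k"
    and ind: "\<And>S. S \<subseteq> {..<n} \<Longrightarrow> card S = k \<Longrightarrow> E \<inter> pairs S \<noteq> {}"
    and card: "l * (k - 1) < n - card W"
  shows "\<not> colorable (with_proj (graph_of E W m)) l"
proof
  assume "colorable (with_proj (graph_of E W m)) l"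
  then obtain f where f: "\<And>x. x < m \<Longrightarrow> f x < l"
    "\<And>x y. {x, y} \<in> E \<Longrightarrow> x \<notin> W \<Longrightarrow> y \<notin> W \<Longrightarrow> f x \<noteq> f y"
    by (fastforce simp: colorable_def proper_coloring_def)
  let ?C = "\<lambda>c. {x\<in>{..<n} - W. f x = c}"
  have color_class: "card (?C c) \<le> k - 1" for c
  proof (rule ccontr)
    assume "\<not> card (?C c) \<le> k - 1"
    then have "k \<le> card (?C c)" using k by simp
    then obtain S where S: "S \<subseteq> ?C c" "card S = k" by (meson obtain_subset_with_card_n)
    then obtain e where "e \<in> E" "e \<in> pairs S" using ind[of S] by blast
    then obtain x y where "{x, y} \<in> E" "x \<in> S" "y \<in> S" unfolding pairs_def card_2_iff by auto
    then show False using f(2)[of x y] S(1) by auto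
  qed
  have "n - card W = card ({..<n} - W)"
    using W by (simp add: card_Diff_subset finite_subset)
  also have "\<dots> \<le> card (\<Union>c<l. ?C c)"
    using f(1) m by (intro card_mono) auto
  also have "\<dots> \<le> (\<Sum>c<l. card (?C c))" by (rule card_UN_le) simp
  also have "\<dots> \<le> (\<Sum>c<l. k - 1)" by (intro sum_mono color_class)
  finally show False using card by simp
qed

text \<open>
  Since isolated vertices can be added, no \<open>m \<ge> n\<close> forces an \<open>l\<close>-coloring. Hence the threshold is
  finite and smaller than \<open>n\<close>.
\<close>

lemma local_threshold_less:
  assumes "E \<subseteq> pairs {..<n}" "W \<subseteq> {..<n}" "0 < n" "0 < k"
    and "\<And>v. v \<in> {..<n} - W \<Longrightarrow> colorable_on E 3 (nball E v r)"
    and "\<And>S. S \<subseteq> {..<n} \<Longrightarrow> card S = k \<Longrightarrow> E \<inter> pairs S \<noteq> {}"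
    and "l * (k - 1) < n - card W"
  shows "\<exists>t<n. local_threshold 3 l r = enat t"
proof -
  have not_forced: "\<not> locally_forces_colorable 3 l r m" if "n \<le> m" for m
  proof -
    have "0 < m" using assms(3) that by simp
    then show ?thesis
      using pair_graph_graph_of[OF assms(1) that]
        local_chromatic_number_graph_of[OF assms(1) that _ assms(2,5)]
        not_colorable_graph_of[OF that assms(2,4,6,7)]
      unfolding locally_forces_colorable_def by (metis card_lessThan graph_of_simps(1))
  qed
  then have bound: "\<forall>m. locally_forces_colorable 3 l r m \<longrightarrow> m \<le> n" by (meson nat_le_linear)
  define t where "t = (GREATEST m. locally_forces_colorable 3 l r m)"
  have t: "locally_forces_colorable 3 l r t" unfolding t_def
    by (rule GreatestI_nat[where k = 0 and b = n]) (use bound locally_forces_colorable_0 in blast)+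
  have "m \<le> t" if "locally_forces_colorable 3 l r m" for m
    unfolding t_def by (rule Greatest_le_nat[where b = n]) (use bound that in blast)+
  then have "local_threshold 3 l r = enat t"
    using t by (simp add: local_threshold_eq_enat_iff)
  moreover have "t < n" using t not_forced by (meson not_le)
  ultimately show ?thesis by blast
qed

section \<open>Choice of the parameters\<close>

text \<open>
  With average degree \<open>d = x / 4\<close> and degree bound \<open>D = x / 2\<close>, the number \<open>R * odds\<close>, which bounds
  the expected degree inside the outermost layer, is at most about $2^{-q-3}$. The last claim bounds the
  probability that a vertex is bad. For \<open>q = 0\<close> the threshold 1 is used: the inner part is a single
  vertex and \<open>Q\<^sup>2 * odds\<close> is small. For \<open>q > 0\<close> the expected number of chords need not be
  small, but it is a small fraction of the threshold \<open>1 / 36 / (n\<^sup>2 * p ^ 3)\<close>.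
\<close>

lemma parameter_bounds:
  fixes x n d p D R Q odds :: real and q :: nat
  assumes x: "1000 \<le> x" and n: "x ^ (q + 2) - 1 \<le> n" "n \<le> x ^ (q + 2)"
  defines "d \<equiv> x / 4" and "p \<equiv> x / 4 / n"
  defines "D \<equiv> 2 * d"
  defines "R \<equiv> D ^ Suc q" and "Q \<equiv> \<Sum>j\<le>q. D ^ j" and "odds \<equiv> p / (1 - p)"
  shows "0 < p" "p < 1" "d = n * p" "1 \<le> d" "0 < n" "x \<le> n" "R * odds < 1"
    "(R * odds) ^ 3 / (1 - R * odds) +
      Q\<^sup>2 * odds * (1 + 3 * (R * odds / (1 - R * odds)\<^sup>2)) / max 1 (1 / 36 / (n\<^sup>2 * p ^ 3)) \<le> 1 / 20"
proof -
  define N where "N = x ^ (q + 2)"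
  have "x * 1000 \<le> x * x" using x by (intro mult_left_mono) auto
  also have "\<dots> * 1 \<le> x * x * x ^ q" using x by (intro mult_left_mono one_le_power) auto
  finally have Nx: "1000 * x \<le> N" by (simp add: N_def power_add power2_eq_square mult_ac)
  have nN: "99 / 100 * N \<le> n" "n \<le> N" using n Nx x unfolding N_def by linarith+
  then show npos: "0 < n" using Nx x by linarith
  show "x \<le> n" using nN Nx x by linarith
  show p0: "0 < p" using npos x by (simp add: p_def)
  have p1: "p \<le> 1 / 100" using npos x nN Nx by (simp add: p_def field_simps)
  then show "p < 1" by simp
  show "d = n * p" using npos by (simp add: d_def p_def)
  show "1 \<le> d" using x by (simp add: d_def)
  have odds: "0 \<le> odds" "odds \<le> 100 / 99 * p"
    using p0 p1 by (auto simp: odds_def field_simps)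
  define r where "r = R * odds"
  have D: "D = x / 2" by (simp add: D_def d_def)
  have R0: "0 \<le> R" using x by (simp add: R_def D)
  have r0: "0 \<le> r" using odds R0 by (simp add: r_def)
  have Nn: "N / n \<le> 100 / 99" "0 \<le> N / n" using nN npos Nx x by (auto simp: field_simps)
  have r1: "r \<le> (100 / 99)\<^sup>2 / (8 * 2 ^ q)"
  proof -
    have "r \<le> R * (100 / 99 * p)" unfolding r_def using odds R0 by (intro mult_left_mono) auto
    also have "R * p = N / n / (8 * 2 ^ q)"
      by (simp add: R_def D p_def N_def power_divide power_add power2_eq_square field_simps)
    then have "R * (100 / 99 * p) = 100 / 99 * (N / n) / (8 * 2 ^ q)" by (simp add: mult_ac)
    also have "\<dots> \<le> 100 / 99 * (100 / 99) / (8 * 2 ^ q)"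
      using Nn by (intro divide_right_mono mult_left_mono) auto
    finally show ?thesis by (simp add: power2_eq_square)
  qed
  have cube: "r ^ 3 / (1 - r) \<le> b ^ 3 / (1 - b)"
    and frac: "1 + 3 * (r / (1 - r)\<^sup>2) \<le> 1 + 3 * (b / (1 - b)\<^sup>2)"
    if "r \<le> b" "b < 1" for b
  proof -
    show "r ^ 3 / (1 - r) \<le> b ^ 3 / (1 - b)"
      using that r0 by (intro frac_le power_mono) auto
    have "r / (1 - r)\<^sup>2 \<le> b / (1 - b)\<^sup>2"
      using that r0 by (intro frac_le power_mono) auto
    then show "1 + 3 * (r / (1 - r)\<^sup>2) \<le> 1 + 3 * (b / (1 - b)\<^sup>2)" by simp
  qed
  have r8: "r \<le> 13 / 100"
  proof -
    have "(100 / 99)\<^sup>2 / (8 * 2 ^ q) \<le> (100 / 99)\<^sup>2 / (8 * 1 :: real)"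
      by (intro divide_left_mono mult_left_mono one_le_power) auto
    also have "\<dots> \<le> 13 / 100" by (simp add: power2_eq_square)
    finally show ?thesis using r1 by linarith
  qed
  then show "R * odds < 1" by (simp add: r_def)
  let ?F = "1 + 3 * (r / (1 - r)\<^sup>2)"
  have F0: "0 \<le> ?F" using r0 by simp
  let ?s = "1 / 36 / (n\<^sup>2 * p ^ 3)"
  have "r ^ 3 / (1 - r) + Q\<^sup>2 * odds * ?F / max 1 ?s \<le> 1 / 20"
  proof (cases "q = 0")
    case True
    have "Q\<^sup>2 * odds * ?F / max 1 ?s \<le> Q\<^sup>2 * odds * ?F / 1"
      using odds F0 by (intro divide_left_mono mult_nonneg_nonneg) auto
    also have "\<dots> = odds * ?F" using True by (simp add: Q_def)
    also have "\<dots> \<le> (100 / 99 * (1 / 100)) * (1 + 3 * ((13 / 100) / (1 - 13 / 100)\<^sup>2))"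
      using odds p1 F0 frac[OF r8] by (intro mult_mono) auto
    also have "\<dots> \<le> 2 / 100" by (simp add: power2_eq_square)
    finally have "Q\<^sup>2 * odds * ?F / max 1 ?s \<le> 2 / 100" .
    moreover have "(13 / 100) ^ 3 / (1 - 13 / 100) \<le> (1 / 100 :: real)" by (simp add: power3_eq_cube)
    ultimately show ?thesis using cube[OF r8] by linarith
  next
    case False
    have r16: "r \<le> 64 / 1000"
    proof -
      have "(2::real) ^ 1 \<le> 2 ^ q" using False by (intro power_increasing) auto
      then have "(100 / 99)\<^sup>2 / (8 * 2 ^ q) \<le> (100 / 99)\<^sup>2 / (8 * 2 :: real)"
        by (intro divide_left_mono mult_left_mono) auto
      also have "\<dots> \<le> 64 / 1000" by (simp add: power2_eq_square)
      finally show ?thesis using r1 by linarith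
    qed
    have Q0: "0 \<le> Q" unfolding Q_def using x by (intro sum_nonneg) (simp add: D)
    have "(D - 1) * Q = D ^ Suc q - 1"
      unfolding Q_def using power_diff_1_eq[of D "Suc q"] by (simp only: lessThan_Suc_atMost)
    then have "(D - 1) * Q \<le> D * D ^ q" by simp
    moreover have "100 / 101 * D * Q \<le> (D - 1) * Q"
      using Q0 x by (intro mult_right_mono) (auto simp: D)
    ultimately have "D * Q \<le> D * (101 / 100 * D ^ q)" by linarith
    moreover have "0 < D" using x by (simp add: D)
    ultimately have Q: "Q \<le> 101 / 100 * D ^ q" by (rule mult_left_le_imp_le)
    have s0: "0 < ?s" using npos p0 by simp
    have "Q\<^sup>2 * odds * ?F / max 1 ?s \<le> Q\<^sup>2 * odds * ?F / ?s"
      using odds F0 s0 by (intro divide_left_mono mult_nonneg_nonneg mult_pos_pos) auto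
    also have "\<dots> = 36 * (Q\<^sup>2 * odds * ?F * (n\<^sup>2 * p ^ 3))" by simp
    also have "\<dots> \<le> 36 * ((101 / 100 * D ^ q)\<^sup>2 * (100 / 99 * p) * ?F * (n\<^sup>2 * p ^ 3))"
      using odds F0 npos p0 Q0 Q
      by (intro mult_left_mono mult_right_mono mult_mono power_mono) auto
    also have "\<dots> = 36 * (101 / 100)\<^sup>2 * (100 / 99) * ?F * ((D ^ q)\<^sup>2 * (n\<^sup>2 * p ^ 4))"
      by (simp add: power_mult_distrib power_divide numeral_eq_Suc mult_ac)
    also have "(D ^ q)\<^sup>2 * (n\<^sup>2 * p ^ 4) = (N / n)\<^sup>2 / (256 * 4 ^ q)"
    proof -
      have "n\<^sup>2 * p ^ 4 = x ^ 4 / (256 * n\<^sup>2)"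
        using npos by (simp add: p_def power_divide power_mult_distrib field_simps numeral_eq_Suc)
      moreover have "(D ^ q)\<^sup>2 = (x ^ q)\<^sup>2 / 4 ^ q"
        by (simp add: D power_divide power_mult[symmetric] mult.commute[of q 2]) (simp add: power_mult)
      moreover have "N\<^sup>2 = (x ^ q)\<^sup>2 * x ^ 4"
        by (simp add: N_def power_add power_mult_distrib flip: power_mult)
      ultimately show ?thesis by (simp add: power_divide mult_ac)
    qed
    also have "36 * (101 / 100)\<^sup>2 * (100 / 99) * ?F * ((N / n)\<^sup>2 / (256 * 4 ^ q)) \<le>
        36 * (101 / 100)\<^sup>2 * (100 / 99) * (1 + 3 * ((64 / 1000) / (1 - 64 / 1000)\<^sup>2)) *
        ((100 / 99)\<^sup>2 / (256 * 4))"
    proof (rule mult_mono[OF mult_left_mono])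
      show "?F \<le> 1 + 3 * ((64 / 1000) / (1 - 64 / 1000)\<^sup>2)" by (rule frac[OF r16]) simp
      have "(4::real) ^ 1 \<le> 4 ^ q" using False by (intro power_increasing) auto
      then show "(N / n)\<^sup>2 / (256 * 4 ^ q) \<le> (100 / 99)\<^sup>2 / (256 * 4)"
        by (intro frac_le[OF _ power_mono[OF Nn]]) auto
    qed auto
    also have "\<dots> \<le> 47 / 1000" by (simp add: power2_eq_square)
    finally have "Q\<^sup>2 * odds * ?F / max 1 ?s \<le> 47 / 1000" .
    moreover have "(64 / 1000) ^ 3 / (1 - 64 / 1000) \<le> (1 / 1000 :: real)" by (simp add: power3_eq_cube)
    ultimately show ?thesis using cube[OF r16] by linarith
  qed
  then show "(R * odds) ^ 3 / (1 - R * odds) +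
      Q\<^sup>2 * odds * (1 + 3 * (R * odds / (1 - R * odds)\<^sup>2)) / max 1 ?s \<le> 1 / 20"
    by (simp only: r_def)
qed

lemma eventually_degree_bound:
  "eventually (\<lambda>x::real. x ^ m * (exp (x / 4) / 2 powr (2 * (x / 4))) \<le> 1 / 100) at_top"
proof -
  \<comment> \<open>The function equals \<open>x ^ m * exp (- (c * x))\<close>, and \<open>c > 0\<close> because \<open>exp 1 < 4\<close>.\<close>
  define c :: real where "c = (2 * ln 2 - 1) / 4"
  have "exp 1 < (4::real)" using exp_le by linarith
  then have "1 < ln (4::real)" by (metis exp_gt_zero exp_less_cancel_iff exp_ln less_trans)
  also have "ln (4::real) = 2 * ln 2" using ln_realpow[of 2 2] by simp
  finally have c: "0 < c" by (simp add: c_def)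
  have "filterlim (\<lambda>x. c * x) at_top at_top"
    by (rule filterlim_tendsto_pos_mult_at_top[OF tendsto_const c filterlim_ident])
  then have "((\<lambda>x. (c * x) ^ m / exp (c * x)) \<longlongrightarrow> 0) at_top"
    by (rule filterlim_compose[OF tendsto_power_div_exp_0])
  then have "eventually (\<lambda>x. (c * x) ^ m / exp (c * x) < c ^ m / 100) at_top"
    by (rule order_tendstoD) (use c in simp)
  then show ?thesis
  proof eventually_elim
    case (elim x)
    have "x / 4 - 2 * (x / 4) * ln 2 = - (c * x)" by (simp add: c_def field_simps)
    then have e: "exp (x / 4) / 2 powr (2 * (x / 4)) = 1 / exp (c * x)"
      by (simp add: powr_def exp_diff[symmetric] exp_minus inverse_eq_divide)
    have "c ^ m * (x ^ m * (1 / exp (c * x))) < c ^ m * (1 / 100)"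
      using elim by (simp add: power_mult_distrib)
    then have "x ^ m * (1 / exp (c * x)) < 1 / 100"
      using c by (simp only: mult_less_cancel_left_pos zero_less_power)
    then show ?case unfolding e by simp
  qed
qed

lemma eventually_color_bound:
  "eventually (\<lambda>l::nat. 2 * real l * ln (10 * real l * ln (real l) / 4) /
    (10 * real l * ln (real l) / 4) \<le> 17 / 20) at_top"
  by real_asymp

lemma eventually_large:
  "eventually (\<lambda>l::nat. real l / (10 * real l * ln (real l)) \<le> 1 / 100) at_top"
  "eventually (\<lambda>l::nat. 1000 \<le> 10 * real l * ln (real l)) at_top"
  "eventually (\<lambda>l::nat. 150 \<le> ln (10 * real l * ln (real l) / 4)) at_top"
  "filterlim (\<lambda>l::nat. 10 * real l * ln (real l)) at_top at_top"
  by real_asymp+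

lemma independence_bound:
  fixes n d p :: real and k :: nat
  assumes n: "0 < n" and d: "1 \<le> d" "150 \<le> ln d" and p: "p = d / n"
    and k: "2 * n * ln d / d \<le> real k - 1" "0 < k"
  shows "(exp 1 * n / real k * exp (- (p * (real k - 1) / 2))) ^ k \<le> 1 / 100"
proof -
  let ?b = "exp 1 * n / real k * exp (- (p * (real k - 1) / 2))"
  have d0: "0 < d" "0 < ln d" using d by linarith+
  have k': "0 < 2 * n * ln d / d" using n d0 by (intro divide_pos_pos mult_pos_pos) auto
  have k'': "2 * n * ln d / d \<le> real k" using k by linarith
  have "ln d = d / n * (2 * n * ln d / d) / 2" using n d0 by simp
  also have "\<dots> \<le> d / n * (real k - 1) / 2"
    using n d0 k(1) by (intro divide_right_mono mult_left_mono) auto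
  finally have "ln d \<le> p * (real k - 1) / 2" by (simp add: p)
  then have "exp (- (p * (real k - 1) / 2)) \<le> exp (- ln d)" by simp
  also have "\<dots> = 1 / d" using d0 by (simp add: exp_minus divide_inverse)
  finally have e: "exp (- (p * (real k - 1) / 2)) \<le> 1 / d" .
  have "?b \<le> exp 1 * n / (2 * n * ln d / d) * (1 / d)"
    using n k' k'' k(2) e d0 by (intro mult_mono divide_left_mono mult_pos_pos) auto
  also have "\<dots> = exp 1 / (2 * ln d)" using n d0 by simp
  also have "\<dots> \<le> 3 / (2 * 150)" using exp_le d by (intro frac_le) auto
  finally have b: "?b \<le> 1 / 100" by simp
  have b0: "0 \<le> ?b" using n by simp
  have "?b ^ k \<le> ?b ^ 1" using b b0 k by (intro power_decreasing) auto
  then have "?b ^ k \<le> ?b" by (simp only: power_one_right)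
  then show ?thesis using b by (rule order.trans)
qed

text \<open>
  The number \<open>m\<close> bounds the sizes of independent sets. With \<open>l\<close> colors, at most \<open>l * m\<close> of the vertices
  outside \<open>W\<close> can be colored, which is about \<open>(4 / 5) * n\<close>, while at least \<open>(9 / 10) * n\<close> keep their edges.
\<close>

lemma local_threshold_bound:
  fixes l q :: nat
  defines "x \<equiv> 10 * real l * ln (real l)"
  assumes x: "1000 \<le> x" and lnd: "150 \<le> ln (x / 4)"
    and deg: "x ^ (q + 2) * (exp (x / 4) / 2 powr (2 * (x / 4))) \<le> 1 / 100"
    and col: "2 * real l * ln (x / 4) / (x / 4) \<le> 17 / 20" and lx: "real l / x \<le> 1 / 100"
  shows "ereal_of_enat (local_threshold 3 l (Suc q)) < ereal (x ^ (q + 2))"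
proof -
  define N where "N = nat \<lfloor>x ^ (q + 2)\<rfloor>"
  define n where "n = real N"
  define d where "d = x / 4"
  define p where "p = d / n"
  define m where "m = nat \<lceil>2 * n * ln d / d\<rceil>"
  define k where "k = Suc m"
  have "0 \<le> x ^ (q + 2)" using x by simp
  then have n: "x ^ (q + 2) - 1 \<le> n" "n \<le> x ^ (q + 2)" unfolding n_def N_def by linarith+
  note par = parameter_bounds[OF x n, folded d_def, folded p_def]
  have k1: "real m \<le> 2 * n * ln d / d + 1" and k2: "2 * n * ln d / d \<le> real k - 1"
    using lnd par(4,5) by (auto simp: m_def k_def d_def)
  have card: "real (card {..<N}) = n" by (simp add: n_def)
  obtain E W where E: "E \<subseteq> pairs {..<N}" "W \<subseteq> {..<N}" "real (card W) \<le> n / 10"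
    and ind: "\<And>S. S \<subseteq> {..<N} \<Longrightarrow> card S = k \<Longrightarrow> E \<inter> pairs S \<noteq> {}"
    and ball: "\<And>v. v \<in> {..<N} - W \<Longrightarrow> colorable_on E 3 (nball E v (Suc q))"
  proof (rule locally_3_colorable_random_graph[of "{..<N}" p d k q, unfolded card, OF _ par(1-4)])
    have "n * (exp d / 2 powr (2 * d)) \<le> x ^ (q + 2) * (exp d / 2 powr (2 * d))"
      using n(2) by (intro mult_right_mono) auto
    also have "\<dots> \<le> 1 / 100" using deg unfolding d_def .
    finally show "n * (exp d / 2 powr (2 * d)) \<le> 1 / 100" .
    show "(exp 1 * n / real k * exp (- (p * (real k - 1) / 2))) ^ k \<le> 1 / 100"
      by (rule independence_bound[OF par(5,4) _ p_def k2]) (use lnd in \<open>auto simp: d_def k_def\<close>)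
  qed (use par(7,8) that in \<open>auto simp: k_def\<close>)
  have "real l * real m \<le> real l * (2 * n * ln d / d + 1)"
    using k1 by (intro mult_left_mono) auto
  also have "\<dots> = n * (2 * real l * ln d / d) + real l" by (simp add: algebra_simps)
  also have "\<dots> \<le> n * (17 / 20) + n / 100"
  proof (intro add_mono mult_left_mono)
    show "2 * real l * ln d / d \<le> 17 / 20" using col by (simp add: d_def)
    have "real l \<le> x / 100" using lx x by (simp add: field_simps)
    then show "real l \<le> n / 100" using par(6) by simp
  qed (use par(5) in auto)
  also have "\<dots> < n - n / 10" using par(5) by simp
  also have "\<dots> \<le> real N - real (card W)" using E(3) by (simp add: n_def)
  finally have "real (l * m + card W) < real N" by simp
  then have "l * m + card W < N" by (simp only: of_nat_less_iff)
  then have lk: "l * (k - 1) < N - card W" by (simp add: k_def less_diff_conv)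
  have "0 < N" using par(5) by (simp add: n_def)
  from local_threshold_less[OF E(1,2) this _ ball ind lk]
  obtain t where t: "t < N" "local_threshold 3 l (Suc q) = enat t" by (auto simp: k_def)
  have "real t < x ^ (q + 2)" using t(1) n(2) by (simp add: n_def)
  then show ?thesis using t(2) by simp
qed

theorem theorem5p1:
  fixes r :: nat
  assumes "r > 0"
  shows "\<exists>l0 :: nat. \<forall>l :: nat. l > l0 \<longrightarrow>
    ereal_of_enat (local_threshold 3 l r) < ereal ((10 * real l * ln (real l)) ^ (r + 1))"
proof -
  obtain q where r: "r = Suc q" using assms gr0_implies_Suc by blast
  have "eventually (\<lambda>l. ereal_of_enat (local_threshold 3 l r) <
      ereal ((10 * real l * ln (real l)) ^ (r + 1))) at_top"
    using eventually_large(1-3) eventually_color_bound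
      eventually_compose_filterlim[OF eventually_degree_bound[of "q + 2"] eventually_large(4)]
  proof eventually_elim
    case (elim l)
    then have "ereal_of_enat (local_threshold 3 l (Suc q)) < ereal ((10 * real l * ln (real l)) ^ (q + 2))"
      by (intro local_threshold_bound)
    then show ?case by (simp add: r)
  qed
  then show ?thesis by (meson eventually_at_top_linorder less_imp_le)
qed

end
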